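(* Define integers $b_{21}(n)$ by $\sum_{n\ge 0} b_{21}(n)q^n = \prod_{i\ge 1}\frac{1-q^{21i}}{1-q^{i}}$, and set $b_{21}(m)=0$ for $m<0$. Let $p$ be a prime with $p\equiv 13, 17, 19,$ or $23 \pmod{24}$, and let $c$ be an integer with $24c\equiv 1 \pmod{p^2}$. Then $$b_{21}\bigl(4(p^2 n + kp - 11c)+1\bigr)\equiv 0 \pmod 2$$ for all integers $n\ge 0$ and all $1\le k<p$.
   Context: For example, for $p=13$ this gives $b_{21}(4\cdot 13^2 n+52k+309)\equiv 0\pmod 2$ for $1\le k\le 12$. *)

theory Defs
  imports
    "HOL-Analysis.Infinite_Products"
    "HOL-Computational_Algebra.Formal_Power_Series"
    "HOL-Number_Theory.Cong"
begin

text \<open>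
  The infinite product is taken in the ring of formal power series with its usual (X-adic) topology.
  The coefficients are rational because the library only divides series over types
  with an inverse operation. The index is shifted by one: factor \<open>i\<close> here is factor \<open>i + 1\<close>
  of the product over \<open>i \<ge> 1\<close>.
\<close>

definition b21_factor :: "nat \<Rightarrow> rat fps" where
  "b21_factor i = (1 - fps_X ^ (21 * (i + 1))) / (1 - fps_X ^ (i + 1))"

definition b21_gf :: "rat fps" where
  "b21_gf = (\<Prod>i. b21_factor i)"

text \<open>
  The floor only serves to get from \<^typ>\<open>rat\<close> to \<^typ>\<open>int\<close>: the coefficients are integers, see
  \<open>of_int_b21\<close> and \<open>b21_gf_eq\<close> below.
\<close>

definition b21 :: "int \<Rightarrow> int" where
  "b21 m = (if m < 0 then 0 else \<lfloor>fps_nth b21_gf (nat m)\<rfloor>)"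

lemma b21_factor_eq: "b21_factor i = (\<Sum>j<21. fps_X ^ ((i + 1) * j))"
proof -
  define x :: "rat fps" where "x = fps_X ^ (i + 1)"
  have nz: "fps_nth (1 - x) 0 \<noteq> 0"
    by (simp add: x_def)
  have "1 - x ^ 21 = (1 - x) * (\<Sum>j<21. x ^ j)"
    by (rule one_diff_power_eq)
  hence "(1 - x ^ 21) / (1 - x) = (\<Sum>j<21. x ^ j)"
    using nz by (metis fps_zero_nth nonzero_mult_div_cancel_left)
  thus ?thesis
    unfolding b21_factor_def x_def power_mult [symmetric] by (simp only: mult.commute)
qed

lemma fps_nth_b21_factor_0: "fps_nth (b21_factor i) 0 = 1"
proof -
  have "fps_nth (b21_factor i) 0 = (\<Sum>j<(21::nat). if j = 0 then 1 else 0 :: rat)"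
    unfolding b21_factor_eq fps_sum_nth by (intro sum.cong) auto
  thus ?thesis by simp
qed

lemma fps_nth_b21_factor_eq_0: "0 < n \<Longrightarrow> n \<le> i \<Longrightarrow> fps_nth (b21_factor i) n = 0"
proof -
  assume n: "0 < n" "n \<le> i"
  have ne: "n \<noteq> (i + 1) * j" for j
    using n by (cases j) auto
  show ?thesis
    unfolding b21_factor_eq fps_sum_nth
    by (intro sum.neutral) (use ne in \<open>auto simp: fps_X_power_iff\<close>)
qed

lemma fps_nth_b21_factor_Ints: "fps_nth (b21_factor i) n \<in> \<int>"
  unfolding b21_factor_eq fps_sum_nth by (intro Ints_sum) (auto simp: fps_X_power_iff)

lemma fps_nth_prod_b21_factor_Ints: "fps_nth (\<Prod>i\<le>N. b21_factor i) n \<in> \<int>"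
proof (induction N arbitrary: n)
  case 0
  show ?case by (simp add: fps_nth_b21_factor_Ints)
next
  case (Suc N)
  show ?case
    unfolding prod.atMost_Suc fps_mult_nth
    by (intro Ints_sum Ints_mult Suc.IH fps_nth_b21_factor_Ints)
qed

lemma fps_nth_prod_b21_factor_stable:
  assumes "n \<le> N"
  shows "fps_nth (\<Prod>i\<le>N. b21_factor i) n = fps_nth (\<Prod>i\<le>n. b21_factor i) n"
  using assms
proof (induction N rule: dec_induct)
  case (step N)
  have "fps_nth (\<Prod>i\<le>Suc N. b21_factor i) n =
      (\<Sum>j=0..n. fps_nth (\<Prod>i\<le>N. b21_factor i) j * fps_nth (b21_factor (Suc N)) (n - j))"
    by (simp only: prod.atMost_Suc fps_mult_nth)
  also have "\<dots> = (\<Sum>j\<in>{n}. fps_nth (\<Prod>i\<le>N. b21_factor i) j * fps_nth (b21_factor (Suc N)) (n - j))"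
    by (intro sum.mono_neutral_right) (use step.hyps in \<open>auto intro!: fps_nth_b21_factor_eq_0\<close>)
  also have "\<dots> = fps_nth (\<Prod>i\<le>N. b21_factor i) n"
    by (simp add: fps_nth_b21_factor_0)
  finally show ?case
    using step.IH by simp
qed simp

lemma b21_factor_has_prod_aux:
  "b21_factor has_prod Abs_fps (\<lambda>n. fps_nth (\<Prod>i\<le>n. b21_factor i) n)" (is "_ has_prod ?P")
proof -
  have "(\<lambda>N. \<Prod>i\<le>N. b21_factor i) \<longlonglongrightarrow> ?P"
  proof (rule tendsto_fpsI)
    fix n
    show "eventually (\<lambda>N. fps_nth (\<Prod>i\<le>N. b21_factor i) n = fps_nth ?P n) sequentially"
      using eventually_ge_at_top[of n]
      by eventually_elim (metis fps_nth_prod_b21_factor_stable fps_nth_Abs_fps)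
  qed
  moreover have "fps_nth ?P 0 \<noteq> 0"
    by (simp add: fps_nth_b21_factor_0)
  hence "?P \<noteq> 0"
    by (metis fps_zero_nth)
  ultimately show ?thesis
    by (simp add: has_prod_def raw_has_prod_def)
qed

lemma b21_factor_has_prod: "b21_factor has_prod b21_gf"
  using b21_factor_has_prod_aux has_prod_unique unfolding b21_gf_def by metis

lemma of_int_b21: "of_int (b21 (int n)) = fps_nth b21_gf n"
proof -
  have "b21_gf = Abs_fps (\<lambda>n. fps_nth (\<Prod>i\<le>n. b21_factor i) n)"
    using b21_factor_has_prod_aux has_prod_unique unfolding b21_gf_def by metis
  hence "fps_nth b21_gf n = fps_nth (\<Prod>i\<le>n. b21_factor i) n"
    by (metis fps_nth_Abs_fps)
  hence "fps_nth b21_gf n \<in> \<int>"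
    using fps_nth_prod_b21_factor_Ints by simp
  thus ?thesis
    by (simp add: b21_def)
qed

lemma b21_gf_eq: "Abs_fps (\<lambda>n. of_int (b21 (int n))) = b21_gf"
  by (simp add: of_int_b21 fps_eq_iff)

end

theory Submission
  imports Defs "HOL-Library.Z2" "HOL-Library.Disjoint_Sets" "HOL-Library.Discrete_Functions"
begin

text \<open>
  Write \<open>f\<^sub>m\<close> for the product of all \<open>1 - q\<^bsup>mi\<^esup>\<close>. Modulo 2 one has
  \<open>f\<^sub>2\<^sub>m = f\<^sub>m\<^sup>2\<close>, \<open>f\<^sub>1\<^sup>3 f\<^sub>3\<^sup>3 = f\<^sub>4\<^sup>3 + q f\<^sub>1\<^sub>2\<^sup>3\<close> and
  \<open>f\<^sub>1 f\<^sub>7 = f\<^sub>8 + q f\<^sub>4 f\<^sub>2\<^sub>8 + q\<^sup>2 f\<^sub>5\<^sub>6\<close>. The last two identities are parity statements about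
  representations by \<open>x\<^sup>2 + 3 y\<^sup>2\<close> and \<open>x\<^sup>2 + 7 y\<^sup>2\<close>, because the triple product turns
  \<open>f\<^sub>m\<^sup>3\<close> into a theta series. They make \<open>f\<^sub>2\<^sub>1 / f\<^sub>1\<close> a sum of terms
  \<open>q\<^sup>e G\<^sup>4\<close> with \<open>e = 0, 1, 3, 4, 6, 7\<close>, and a fourth power has only exponents divisible by 4,
  so the coefficients at \<open>4 m + 1\<close> are those of \<open>f\<^sub>3\<^sup>4 / f\<^sub>1 = f\<^sub>3 (f\<^sub>3\<^sup>3 / f\<^sub>1)\<close>.
  Both factors are theta series, hence \<open>b\<^sub>2\<^sub>1(4 m + 1)\<close> has the parity of the number of
  representations \<open>24 m + 11 = 8 (3 y + 1)\<^sup>2 + 3 (6 x - 1)\<^sup>2\<close>. For \<open>m\<close> as in the theorem, \<open>p\<close>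
  divides \<open>24 m + 11\<close> exactly once, whereas -6 is not a square modulo \<open>p\<close>, so that the
  form takes only values divisible by \<open>p\<^sup>2\<close> or prime to \<open>p\<close>.
\<close>

section \<open>Gaussian binomial coefficients\<close>

fun gauss_binomial :: "'a::comm_ring_1 \<Rightarrow> nat \<Rightarrow> nat \<Rightarrow> 'a" where
  "gauss_binomial q n 0 = 1"
| "gauss_binomial q 0 (Suc k) = 0"
| "gauss_binomial q (Suc n) (Suc k) = gauss_binomial q n k + q ^ Suc k * gauss_binomial q n (Suc k)"

lemma gauss_binomial_eq_0: "n < k \<Longrightarrow> gauss_binomial q n k = 0"
  by (induction q n k rule: gauss_binomial.induct) auto

lemma choose_two_Suc: "Suc k * k div 2 = k * (k - 1) div 2 + k"
proof -
  have "Suc k * k = k * (k - 1) + k * 2"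
    by (cases k) auto
  thus ?thesis by simp
qed

text \<open>Splitting off the factor \<open>i = 0\<close> leaves the same product with
  \<open>x * q\<close> for \<open>x\<close>, hence the induction over arbitrary \<open>x\<close>.
  The second variable \<open>y\<close> will be a power of \<open>fps_X\<close>, which keeps negative
  exponents out of the triple product.\<close>

lemma gauss_binomial_theorem:
  "(\<Prod>i<n. y + x * q ^ i) =
     (\<Sum>k\<le>n. gauss_binomial q n k * q ^ (k * (k - 1) div 2) * x ^ k * y ^ (n - k))"
proof (induction n arbitrary: x)
  case 0
  show ?case by simp
next
  case (Suc n)
  define g where "g k = gauss_binomial q n k * q ^ (k * (k - 1) div 2) * (x * q) ^ k" for k
  have g_Suc: "g (Suc k) = q ^ (Suc k * k div 2) * (q ^ Suc k * gauss_binomial q n (Suc k)) * x ^ Suc k" for k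
    by (simp add: g_def power_mult_distrib mult_ac)
  have g_x: "x * g k = q ^ (Suc k * k div 2) * gauss_binomial q n k * x ^ Suc k" for k
    unfolding g_def choose_two_Suc by (simp add: power_mult_distrib power_add mult_ac)
  have "(\<Prod>i<Suc n. y + x * q ^ i) = (y + x) * (\<Prod>i<n. y + (x * q) * q ^ i)"
    by (subst prod.lessThan_Suc_shift) (simp add: mult_ac)
  also have "\<dots> = (y + x) * (\<Sum>k\<le>n. g k * y ^ (n - k))"
    by (simp only: Suc.IH g_def)
  also have "\<dots> = (\<Sum>k\<le>n. g k * y ^ (Suc n - k)) + (\<Sum>k\<le>n. x * g k * y ^ (n - k))"
  proof -
    have "y * (g k * y ^ (n - k)) = g k * y ^ (Suc n - k)" if "k \<le> n" for k
      using that by (simp add: Suc_diff_le mult_ac)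
    thus ?thesis
      by (simp add: distrib_right sum_distrib_left sum.distrib mult.assoc)
  qed
  also have "(\<Sum>k\<le>n. g k * y ^ (Suc n - k)) = (\<Sum>k\<le>Suc n. g k * y ^ (Suc n - k))"
    by (simp add: g_def gauss_binomial_eq_0)
  also have "\<dots> = g 0 * y ^ Suc n + (\<Sum>k\<le>n. g (Suc k) * y ^ (n - k))"
    by (subst sum.atMost_Suc_shift) simp
  also have "\<dots> + (\<Sum>k\<le>n. x * g k * y ^ (n - k)) =
      g 0 * y ^ Suc n + (\<Sum>k\<le>n. (g (Suc k) + x * g k) * y ^ (n - k))"
    by (simp add: distrib_right sum.distrib)
  also have "g 0 = 1" by (simp add: g_def)
  also have "(\<Sum>k\<le>n. (g (Suc k) + x * g k) * y ^ (n - k)) =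
      (\<Sum>k\<le>n. gauss_binomial q (Suc n) (Suc k) * q ^ (Suc k * k div 2) * x ^ Suc k * y ^ (n - k))"
    by (intro sum.cong refl) (simp add: g_Suc g_x algebra_simps)
  finally show ?case
    by (subst sum.atMost_Suc_shift) simp
qed

text \<open>This is the quotient formula with denominators cleared. The two summands of the q-Pascal
  rule contribute the factors \<open>1 - q ^ Suc j\<close> and
  \<open>q ^ Suc j * (1 - q ^ (n - j))\<close>, whose sum is \<open>1 - q ^ Suc n\<close>.\<close>

lemma gauss_binomial_mult_prods:
  assumes "k \<le> n"
  shows "(\<Prod>i<k. 1 - q ^ Suc i) * (\<Prod>i<n - k. 1 - q ^ Suc i) * gauss_binomial q n k =
    (\<Prod>i<n. 1 - q ^ Suc i)"
  using assms
proof (induction n arbitrary: k)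
  case 0
  thus ?case by simp
next
  case (Suc n)
  let ?P = "\<lambda>k. \<Prod>i<k. 1 - q ^ Suc i"
  show ?case
  proof (cases k)
    case 0
    thus ?thesis by simp
  next
    case k: (Suc j)
    have 1: "?P (Suc j) * ?P (n - j) * gauss_binomial q n j = (1 - q ^ Suc j) * ?P n"
    proof -
      have "?P (Suc j) * ?P (n - j) * gauss_binomial q n j =
          (1 - q ^ Suc j) * (?P j * ?P (n - j) * gauss_binomial q n j)"
        by (simp only: prod.lessThan_Suc mult_ac)
      also have "?P j * ?P (n - j) * gauss_binomial q n j = ?P n"
        using Suc.prems k by (intro Suc.IH) simp
      finally show ?thesis .
    qed
    have 2: "?P (Suc j) * ?P (n - j) * gauss_binomial q n (Suc j) = (1 - q ^ (n - j)) * ?P n"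
    proof (cases "j < n")
      case True
      hence P: "?P (n - j) = ?P (n - Suc j) * (1 - q ^ (n - j))"
        using prod.lessThan_Suc[of "\<lambda>i. 1 - q ^ Suc i" "n - Suc j"] Suc_diff_Suc[OF True]
        by (simp only:)
      have "?P (Suc j) * ?P (n - j) * gauss_binomial q n (Suc j) =
          (1 - q ^ (n - j)) * (?P (Suc j) * ?P (n - Suc j) * gauss_binomial q n (Suc j))"
        unfolding P by (simp only: mult_ac)
      also have "?P (Suc j) * ?P (n - Suc j) * gauss_binomial q n (Suc j) = ?P n"
        using True by (intro Suc.IH) simp
      finally show ?thesis .
    next
      case False
      hence "n = j" using Suc.prems k by simp
      thus ?thesis by (simp add: gauss_binomial_eq_0)
    qed
    have "?P (Suc j) * ?P (n - j) * gauss_binomial q (Suc n) (Suc j) =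
        ?P (Suc j) * ?P (n - j) * gauss_binomial q n j
        + q ^ Suc j * (?P (Suc j) * ?P (n - j) * gauss_binomial q n (Suc j))"
      by (simp only: gauss_binomial.simps distrib_left mult_ac)
    also have "\<dots> = (1 - q ^ Suc j + q ^ Suc j * (1 - q ^ (n - j))) * ?P n"
      unfolding 1 2 by (simp only: distrib_right mult.assoc)
    also have "q ^ Suc j * (1 - q ^ (n - j)) = q ^ Suc j - q ^ Suc n"
    proof -
      have "q ^ Suc j * q ^ (n - j) = q ^ Suc n"
        using Suc.prems k by (subst power_add [symmetric]) simp
      thus ?thesis
        by (simp only: right_diff_distrib mult_1_right)
    qed
    also have "1 - q ^ Suc j + (q ^ Suc j - q ^ Suc n) = 1 - q ^ Suc n"
      by simp
    also have "(1 - q ^ Suc n) * ?P n = ?P (Suc n)"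
      by (simp only: prod.lessThan_Suc mult.commute)
    finally show ?thesis
      by (simp only: k diff_Suc_Suc)
  qed
qed

section \<open>Infinite products over the field with two elements\<close>

text \<open>Congruence modulo \<open>fps_X ^ (N + 1)\<close>, by which infinite products are handled
  through finite ones.\<close>

definition fps_cong :: "nat \<Rightarrow> 'a::comm_ring_1 fps \<Rightarrow> 'a fps \<Rightarrow> bool" where
  "fps_cong N F G \<longleftrightarrow> (\<forall>i\<le>N. fps_nth F i = fps_nth G i)"

lemma fps_cong_refl [simp]: "fps_cong N F F"
  and fps_cong_sym: "fps_cong N F G \<Longrightarrow> fps_cong N G F"
  and fps_cong_trans [trans]: "fps_cong N F G \<Longrightarrow> fps_cong N G H \<Longrightarrow> fps_cong N F H"
  and fps_cong_nth: "fps_cong N F G \<Longrightarrow> i \<le> N \<Longrightarrow> fps_nth F i = fps_nth G i"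
  by (simp_all add: fps_cong_def)

lemma fps_cong_all_imp_eq: "(\<And>N. fps_cong N F G) \<Longrightarrow> F = G"
  by (auto simp: fps_cong_def fps_eq_iff)

lemma fps_cong_mult:
  assumes "fps_cong N F G" "fps_cong N F' G'"
  shows "fps_cong N (F * F') (G * G')"
  using assms by (auto simp: fps_cong_def fps_mult_nth intro!: sum.cong)

lemma fps_cong_prod_1:
  assumes "\<And>i. i \<in> A \<Longrightarrow> fps_cong N (h i) 1"
  shows "fps_cong N (\<Prod>i\<in>A. h i) 1"
  using assms
proof (induction A rule: infinite_finite_induct)
  case (insert a A)
  thus ?case using fps_cong_mult[of N "h a" 1 "prod h A" 1] by simp
qed auto

lemma fps_cong_X_power: "N < k \<Longrightarrow> fps_cong N (1 + fps_X ^ k) 1"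
  by (auto simp: fps_cong_def fps_X_power_iff)

lemma fps_cong_mult_cancel:
  fixes F G U :: "'a::field fps"
  assumes "fps_cong N (U * F) (U * G)" "fps_nth U 0 \<noteq> 0"
  shows "fps_cong N F G"
  using fps_cong_mult[OF fps_cong_refl[of N "inverse U"] assms(1)] inverse_mult_eq_1[OF assms(2)]
  by (simp flip: mult.assoc)

text \<open>The index 0 is ignored, so \<open>S\<close> may contain it.\<close>

definition euler_prod :: "nat set \<Rightarrow> bit fps" where
  "euler_prod S = Abs_fps (\<lambda>n. fps_nth (\<Prod>i\<in>S \<inter> {1..n}. 1 + fps_X ^ i) n)"

lemma fps_cong_prod_mono:
  assumes "finite T" "U \<subseteq> T" "\<And>i. i \<in> T - U \<Longrightarrow> N < i"
  shows "fps_cong N (\<Prod>i\<in>T. 1 + fps_X ^ i :: bit fps) (\<Prod>i\<in>U. 1 + fps_X ^ i)"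
proof -
  have "fps_cong N (\<Prod>i\<in>T - U. 1 + fps_X ^ i :: bit fps) 1"
    using assms by (intro fps_cong_prod_1 fps_cong_X_power) auto
  hence "fps_cong N ((\<Prod>i\<in>T - U. 1 + fps_X ^ i :: bit fps) * (\<Prod>i\<in>U. 1 + fps_X ^ i))
      (1 * (\<Prod>i\<in>U. 1 + fps_X ^ i))"
    by (intro fps_cong_mult) auto
  thus ?thesis
    by (simp only: prod.subset_diff[OF assms(2,1)] mult_1)
qed

lemma fps_cong_euler_prod:
  assumes "finite T" "S \<inter> {1..N} \<subseteq> T" "T \<subseteq> S - {0}"
  shows "fps_cong N (euler_prod S) (\<Prod>i\<in>T. 1 + fps_X ^ i)"
  unfolding fps_cong_def
proof (intro allI impI)
  fix n assume n: "n \<le> N"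
  have "fps_cong n (\<Prod>i\<in>T. 1 + fps_X ^ i :: bit fps) (\<Prod>i\<in>S \<inter> {1..n}. 1 + fps_X ^ i)"
    using assms n by (intro fps_cong_prod_mono) fastforce+
  thus "fps_nth (euler_prod S) n = fps_nth (\<Prod>i\<in>T. 1 + fps_X ^ i) n"
    by (simp add: euler_prod_def fps_cong_def)
qed

lemma fps_nth_euler_prod_0 [simp]: "fps_nth (euler_prod S) 0 = 1"
  by (simp add: euler_prod_def)

lemma euler_prod_neq_0 [simp]: "euler_prod S \<noteq> 0"
  using fps_nth_euler_prod_0[of S] by (metis fps_zero_nth zero_neq_one)

lemma euler_prod_union:
  assumes "S \<inter> T \<subseteq> {0}"
  shows "euler_prod (S \<union> T) = euler_prod S * euler_prod T"
proof (rule fps_cong_all_imp_eq)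
  fix N
  have "fps_cong N (euler_prod S * euler_prod T)
      ((\<Prod>i\<in>S \<inter> {1..N}. 1 + fps_X ^ i) * (\<Prod>i\<in>T \<inter> {1..N}. 1 + fps_X ^ i))"
    by (intro fps_cong_mult fps_cong_euler_prod) auto
  also have "(\<Prod>i\<in>S \<inter> {1..N}. 1 + fps_X ^ i) * (\<Prod>i\<in>T \<inter> {1..N}. 1 + fps_X ^ i) =
      (\<Prod>i\<in>(S \<union> T) \<inter> {1..N}. 1 + fps_X ^ i :: bit fps)"
    using assms by (subst prod.union_disjoint [symmetric]) (auto intro!: prod.cong)
  finally have "fps_cong N (euler_prod S * euler_prod T)
      (\<Prod>i\<in>(S \<union> T) \<inter> {1..N}. 1 + fps_X ^ i)" .
  moreover have "fps_cong N (euler_prod (S \<union> T)) (\<Prod>i\<in>(S \<union> T) \<inter> {1..N}. 1 + fps_X ^ i)"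
    by (intro fps_cong_euler_prod) auto
  ultimately show "fps_cong N (euler_prod (S \<union> T)) (euler_prod S * euler_prod T)"
    by (metis fps_cong_sym fps_cong_trans)
qed

lemma bit_fps_add_self [simp]: "F + F = (0 :: bit fps)"
  by (rule fps_ext) (simp only: fps_add_nth fps_zero_nth, simp)

lemma bit_fps_minus: "F - G = (F + G :: bit fps)"
  by (simp add: fps_eq_iff)

lemma bit_fps_2: "2 = (0 :: bit fps)"
  by (simp flip: one_add_one)

lemma bit_fps_add_squared: "(F + G)\<^sup>2 = F\<^sup>2 + (G\<^sup>2 :: bit fps)"
  by (simp add: power2_sum bit_fps_2)

text \<open>Squaring is additive in characteristic 2, so it turns each factor
  \<open>1 + fps_X ^ i\<close> into \<open>1 + fps_X ^ (2 * i)\<close>.\<close>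

lemma euler_prod_double: "euler_prod ((*) 2 ` S) = (euler_prod S)\<^sup>2"
proof (rule fps_cong_all_imp_eq)
  fix N
  have "fps_cong N (euler_prod S)  (\<Prod>i\<in>S \<inter> {1..N}. 1 + fps_X ^ i)"
    by (intro fps_cong_euler_prod) auto
  hence "fps_cong N ((euler_prod S)\<^sup>2) ((\<Prod>i\<in>S \<inter> {1..N}. 1 + fps_X ^ i)\<^sup>2)"
    by (simp add: power2_eq_square fps_cong_mult)
  also have "(\<Prod>i\<in>S \<inter> {1..N}. 1 + fps_X ^ i :: bit fps)\<^sup>2 = (\<Prod>i\<in>S \<inter> {1..N}. 1 + fps_X ^ (2 * i))"
    by (simp add: prod_power_distrib bit_fps_add_squared power_even_eq)
  also have "\<dots> = (\<Prod>i\<in>(*) 2 ` (S \<inter> {1..N}). 1 + fps_X ^ i)"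
    by (subst prod.reindex) (auto simp: inj_on_def)
  finally have "fps_cong N ((euler_prod S)\<^sup>2) \<dots>" .
  moreover have "fps_cong N (euler_prod ((*) 2 ` S)) (\<Prod>i\<in>(*) 2 ` (S \<inter> {1..N}). 1 + fps_X ^ i)"
    by (intro fps_cong_euler_prod) auto
  ultimately show "fps_cong N (euler_prod ((*) 2 ` S)) ((euler_prod S)\<^sup>2)"
    by (metis fps_cong_sym fps_cong_trans)
qed

section \<open>The triple product modulo 2\<close>

text \<open>
  An infinite fibre would be counted as 0; the predicate \<open>admissible\<close> below rules this out.
\<close>

definition count_fps :: "'a set \<Rightarrow> ('a \<Rightarrow> int) \<Rightarrow> bit fps" where
  "count_fps A Q = Abs_fps (\<lambda>n. of_nat (card {x \<in> A. Q x = int n}))"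

section \<open>Theta exponents and the finite form of the triple product\<close>

lemma prod_lessThan_add:
  fixes g :: "nat \<Rightarrow> 'a::comm_monoid_mult"
  shows "(\<Prod>i<m + n. g i) = (\<Prod>i<m. g i) * (\<Prod>i<n. g (m + i))"
  by (induction n) (simp_all add: mult_ac)

text \<open>The exponent of \<open>q\<close> in the term of index \<open>k\<close> of the theta
  series with base \<open>q ^ d\<close> and argument \<open>q ^ s\<close>; the division by 2 is
  exact.\<close>

definition jacobi_exponent :: "nat \<Rightarrow> nat \<Rightarrow> int \<Rightarrow> int" where
  "jacobi_exponent d s k = int d * (k * (k - 1) div 2) + int s * k"

lemma two_jacobi_exponent: "2 * jacobi_exponent d s k = int d * (k * (k - 1)) + 2 * int s * k"
proof -
  have "2 * jacobi_exponent d s k = int d * (2 * (k * (k - 1) div 2)) + 2 * int s * k"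
    unfolding jacobi_exponent_def by (simp only: distrib_left mult.left_commute mult.assoc)
  also have "2 * (k * (k - 1) div 2) = k * (k - 1)"
    by simp
  finally show ?thesis .
qed

text \<open>Hence exponents are nonnegative, each is attained finitely often, and degrees up to
  \<open>n\<close> involve only \<open>\<bar>k\<bar> \<le> n\<close>. For negative \<open>k\<close>,
  twice the exponent is \<open>-k\<close> times a factor that is at least 2.\<close>

lemma abs_le_jacobi_exponent:
  assumes "0 < s" "s < d"
  shows "\<bar>k\<bar> \<le> jacobi_exponent d s k"
proof (cases "k \<ge> 0")
  case True
  have "k * (k - 1) \<ge> 0"
    using True by (cases "k = 0") auto
  hence "int d * (k * (k - 1) div 2) \<ge> 0"
    by (simp only: pos_imp_zdiv_nonneg_iff mult_nonneg_nonneg of_nat_0_le_iff zero_less_numeral)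
  moreover have "1 * k \<le> int s * k"
    using True assms by (intro mult_right_mono) auto
  ultimately show ?thesis
    using True unfolding jacobi_exponent_def by linarith
next
  case False
  have "2 * jacobi_exponent d s k = (-k) * (int d * (1 - k) - 2 * int s)"
    unfolding two_jacobi_exponent by (simp add: algebra_simps)
  moreover have "int d * 2 \<le> int d * (1 - k)"
    using False by (intro mult_left_mono) auto
  hence "2 \<le> int d * (1 - k) - 2 * int s"
    using assms by linarith
  hence "(-k) * 2 \<le> (-k) * (int d * (1 - k) - 2 * int s)"
    using False by (intro mult_left_mono) auto
  ultimately show ?thesis
    using False by linarith
qed

text \<open>Each factor of the first half releases \<open>fps_X ^ (d * i + s)\<close> and each
  factor of the second half \<open>fps_X ^ (d * N)\<close>. What remains runs over the classes of
  \<open>-s\<close> and \<open>s\<close> modulo \<open>d\<close>, and \<open>M\<close> collects the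
  released exponents.\<close>

lemma jacobi_finite_prod:
  fixes d s N :: nat
  assumes "s < d"
  defines "M \<equiv> (\<Sum>i<N. d * i + s) + d * N * N"
  shows "(\<Prod>i<N + N. fps_X ^ (d * N) + fps_X ^ s * (fps_X ^ d) ^ i :: 'a::comm_ring_1 fps) =
     fps_X ^ M * ((\<Prod>i<N. 1 + fps_X ^ (d * Suc i - s)) * (\<Prod>i<N. 1 + fps_X ^ (d * i + s)))"
proof -
  have 1: "fps_X ^ (d * N) + fps_X ^ s * (fps_X ^ d) ^ i =
      fps_X ^ (d * i + s) * (1 + fps_X ^ (d * Suc (N - Suc i) - s) :: 'a fps)" if "i < N" for i
  proof -
    have "i + Suc (N - Suc i) = N"
      using that by simp
    hence "d * N = d * i + d * Suc (N - Suc i)"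
      by (metis distrib_left)
    moreover have "s \<le> d * Suc (N - Suc i)"
      using assms(1) by (simp add: trans_le_add1)
    ultimately have "d * N = (d * i + s) + (d * Suc (N - Suc i) - s)"
      by simp
    thus ?thesis
      by (simp only: power_add power_mult distrib_left) (simp add: mult_ac)
  qed
  have 2: "fps_X ^ (d * N) + fps_X ^ s * (fps_X ^ d) ^ (N + i) =
      fps_X ^ (d * N) * (1 + fps_X ^ (d * i + s) :: 'a fps)" for i
    by (simp only: power_add power_mult distrib_left) (simp add: mult_ac)
  have 3: "(\<Prod>i<N. 1 + fps_X ^ (d * Suc (N - Suc i) - s) :: 'a fps) =
      (\<Prod>i<N. 1 + fps_X ^ (d * Suc i - s))"
    by (rule prod.nat_diff_reindex[of "\<lambda>i. 1 + fps_X ^ (d * Suc i - s)"])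
  have 4: "fps_X ^ M = (\<Prod>i<N. fps_X ^ (d * i + s)) * (\<Prod>i<N. fps_X ^ (d * N) :: 'a fps)"
    by (simp add: M_def power_add power_sum power_mult)
  have 5: "(\<Prod>i<N. fps_X ^ (d * N) + fps_X ^ s * (fps_X ^ d) ^ i :: 'a fps) =
      (\<Prod>i<N. fps_X ^ (d * i + s)) * (\<Prod>i<N. 1 + fps_X ^ (d * Suc i - s))"
    unfolding 3 [symmetric] by (subst prod.distrib [symmetric]) (intro prod.cong refl 1, simp)
  show ?thesis
    unfolding prod_lessThan_add 2 prod.distrib 4 5 by (simp only: mult_ac)
qed

text \<open>Recentring the q-binomial sum at \<open>N\<close> splits off the power \<open>M\<close>
  of \<open>jacobi_finite_prod\<close> and leaves a theta exponent. Both sides are doubled to clear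
  the halves.\<close>

lemma jacobi_exponent_shift:
  fixes d s N k :: nat
  assumes "0 < s" "s < d" "k \<le> N + N"
  shows "d * (k * (k - 1) div 2) + s * k + d * N * (N + N - k) =
    (\<Sum>i<N. d * i + s) + d * N * N + nat (jacobi_exponent d s (int k - int N))"
proof -
  have sum: "2 * int (\<Sum>i<N. d * i + s) = int d * (int N * (int N - 1)) + 2 * int s * int N"
    by (induction N) (simp_all add: algebra_simps)
  have k: "2 * int (k * (k - 1) div 2) = int k * (int k - 1)"
  proof -
    have "2 * (k * (k - 1) div 2) = k * (k - 1)"
      by (rule dvd_mult_div_cancel) (cases k, auto)
    hence "2 * int (k * (k - 1) div 2) = int (k * (k - 1))"
      by (metis of_nat_mult of_nat_numeral)
    also have "\<dots> = int k * (int k - 1)"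
      by (cases k) (simp_all add: algebra_simps)
    finally show ?thesis .
  qed
  have nonneg: "0 \<le> jacobi_exponent d s (int k - int N)"
    using abs_le_jacobi_exponent[OF assms(1,2)] by (meson abs_ge_zero order_trans)
  have cancel: "a = b" if "2 * int a = 2 * int b" for a b
    using that by simp
  have Nk: "int (N + N - k) = 2 * int N - int k"
    using assms(3) by simp
  have "2 * int (d * (k * (k - 1) div 2) + s * k + d * N * (N + N - k)) =
      int d * (2 * int (k * (k - 1) div 2)) + 2 * int s * int k
      + 2 * int d * int N * (2 * int N - int k)"
    unfolding of_nat_add of_nat_mult Nk by (simp add: algebra_simps)
  also have "\<dots> = 2 * int (\<Sum>i<N. d * i + s) + 2 * int d * int N * int N
      + 2 * jacobi_exponent d s (int k - int N)"
    unfolding sum k two_jacobi_exponent by (simp add: algebra_simps)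
  also have "\<dots> = 2 * int ((\<Sum>i<N. d * i + s) + d * N * N + nat (jacobi_exponent d s (int k - int N)))"
    using nonneg by simp
  finally show ?thesis
    by (rule cancel)
qed

definition euler :: "nat \<Rightarrow> bit fps" where
  "euler m = euler_prod {n. m dvd n}"

lemma fps_cong_euler:
  assumes "0 < d" "n \<le> N"
  shows "fps_cong n (euler d) (\<Prod>i<N. 1 - (fps_X ^ d) ^ Suc i)"
proof -
  have "fps_cong n (euler d) (\<Prod>i\<in>(\<lambda>i. d * Suc i) ` {..<N}. 1 + fps_X ^ i)"
    unfolding euler_def
  proof (rule fps_cong_euler_prod)
    show "{n. d dvd n} \<inter> {1..n} \<subseteq> (\<lambda>i. d * Suc i) ` {..<N}"
    proof
      fix m assume m: "m \<in> {n. d dvd n} \<inter> {1..n}"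
      then obtain j where j: "m = d * j" by auto
      with m have "j > 0" by (cases j) auto
      have "1 * j \<le> d * j"
        using assms by (intro mult_right_mono) auto
      also have "\<dots> \<le> n"
        using m j by simp
      finally have "m = d * Suc (j - 1)" "j - 1 < N"
        using \<open>j > 0\<close> j assms by auto
      thus "m \<in> (\<lambda>i. d * Suc i) ` {..<N}" by blast
    qed
  qed (use assms in auto)
  also have "(\<Prod>i\<in>(\<lambda>i. d * Suc i) ` {..<N}. 1 + fps_X ^ i) = (\<Prod>i<N. 1 - (fps_X ^ d) ^ Suc i :: bit fps)"
    using assms by (subst prod.reindex) (auto simp: inj_on_def bit_fps_minus power_add power_mult)
  finally show ?thesis .
qed

text \<open>As \<open>k\<close> and \<open>N - k\<close> grow, the Gaussian binomial tends to the
  inverse of \<open>euler d\<close>. A second factor \<open>euler d\<close> brings in the product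
  formula and is cancelled at the end.\<close>

lemma fps_cong_euler_gauss_binomial:
  assumes "0 < d" "n \<le> k" "n \<le> N - k" "k \<le> N"
  shows "fps_cong n (euler d * gauss_binomial (fps_X ^ d) N k) 1"
proof -
  let ?P = "\<lambda>k. \<Prod>i<k. 1 - (fps_X ^ d) ^ Suc i :: bit fps"
  let ?g = "gauss_binomial (fps_X ^ d) N k"
  have "fps_cong n (euler d * euler d * ?g) (?P k * ?P (N - k) * ?g)"
    using assms by (intro fps_cong_mult fps_cong_euler) auto
  also have "?P k * ?P (N - k) * ?g = ?P N"
    using assms(4) by (rule gauss_binomial_mult_prods)
  also have "fps_cong n (?P N) (euler d * 1)"
    unfolding mult_1_right using assms by (intro fps_cong_sym[OF fps_cong_euler]) auto
  finally show ?thesis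
    unfolding mult.assoc by (rule fps_cong_mult_cancel) (simp add: euler_def)
qed

lemma fps_cong_residue_class:
  assumes "0 < s" "s < d" "n < N"
  shows "fps_cong n (euler_prod {n. n mod d = s}) (\<Prod>i<N. 1 + fps_X ^ (d * i + s))"
proof -
  have "fps_cong n (euler_prod {n. n mod d = s}) (\<Prod>i\<in>(\<lambda>i. d * i + s) ` {..<N}. 1 + fps_X ^ i)"
  proof (rule fps_cong_euler_prod)
    show "{n. n mod d = s} \<inter> {1..n} \<subseteq> (\<lambda>i. d * i + s) ` {..<N}"
    proof
      fix m assume m: "m \<in> {n. n mod d = s} \<inter> {1..n}"
      hence s: "m mod d = s" by simp
      have "m = d * (m div d) + s"
        using mult_div_mod_eq[of d m] unfolding s by (rule sym)
      moreover have "m div d < N"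
        using m assms(3) by (intro le_less_trans[OF div_le_dividend]) simp
      ultimately show "m \<in> (\<lambda>i. d * i + s) ` {..<N}" by blast
    qed
  qed (use assms in auto)
  also have "(\<Prod>i\<in>(\<lambda>i. d * i + s) ` {..<N}. 1 + fps_X ^ i) = (\<Prod>i<N. 1 + fps_X ^ (d * i + s) :: bit fps)"
    using assms by (subst prod.reindex) (auto simp: inj_on_def)
  finally show ?thesis .
qed

text \<open>Multiplying the finite identity by \<open>euler d\<close> removes the Gaussian binomials
  from all terms that reach degree \<open>n\<close>. The hypothesis \<open>2 * s \<noteq> d\<close>
  keeps the classes of \<open>s\<close> and \<open>d - s\<close> disjoint, so that their products
  can be separated.\<close>

lemma jacobi_triple_product_mod_2:
  assumes "0 < s" "s < d" "2 * s \<noteq> d"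
  shows "euler_prod {n. n mod d \<in> {0, s, d - s}} = count_fps UNIV (jacobi_exponent d s)"
proof (rule fps_ext)
  fix n :: nat
  \<comment> \<open>If \<open>e k \<le> n\<close>, then \<open>k\<close> is within \<open>n\<close>
    of \<open>N\<close>; this \<open>N\<close> is large enough that then \<open>n \<le> k\<close>
    and \<open>n \<le> N + N - k\<close>.\<close>
  define N where "N = 2 * n + 1"
  define M where "M = (\<Sum>i<N. d * i + s) + d * N * N"
  define e where "e k = nat (jacobi_exponent d s (int k - int N))" for k
  define g where "g k = gauss_binomial (fps_X ^ d :: bit fps) (N + N) k" for k
  define A B where "A = (\<Prod>i<N. 1 + fps_X ^ (d * Suc i - s) :: bit fps)"
    and "B = (\<Prod>i<N. 1 + fps_X ^ (d * i + s) :: bit fps)"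
  have int_e: "int (e k) = jacobi_exponent d s (int k - int N)" and abs_le_e: "\<bar>int k - int N\<bar> \<le> int (e k)" for k
    using abs_le_jacobi_exponent[OF assms(1,2), of "int k - int N"] by (auto simp: e_def)

  have "fps_X ^ M * (A * B) =
      (\<Sum>k\<le>N + N. g k * (fps_X ^ d) ^ (k * (k - 1) div 2) * (fps_X ^ s) ^ k * (fps_X ^ (d * N)) ^ (N + N - k))"
    unfolding A_def B_def M_def jacobi_finite_prod[OF assms(2), symmetric] g_def
    by (rule gauss_binomial_theorem)
  also have "\<dots> = (\<Sum>k\<le>N + N. fps_X ^ M * (g k * fps_X ^ e k))"
  proof (intro sum.cong refl)
    fix k assume "k \<in> {..N + N}"
    hence "d * (k * (k - 1) div 2) + s * k + d * N * (N + N - k) = M + e k"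
      using jacobi_exponent_shift[of s d k N] assms unfolding M_def e_def by simp
    hence "fps_X ^ (d * (k * (k - 1) div 2) + s * k + d * N * (N + N - k)) = (fps_X ^ (M + e k) :: bit fps)"
      by simp
    thus "g k * (fps_X ^ d) ^ (k * (k - 1) div 2) * (fps_X ^ s) ^ k * (fps_X ^ (d * N)) ^ (N + N - k)
        = fps_X ^ M * (g k * fps_X ^ e k)"
      unfolding power_add power_mult by (simp add: mult_ac)
  qed
  also have "\<dots> = fps_X ^ M * (\<Sum>k\<le>N + N. g k * fps_X ^ e k)"
    by (simp add: sum_distrib_left)
  finally have AB: "A * B = (\<Sum>k\<le>N + N. g k * fps_X ^ e k)"
    by simp

  let ?Z = "{n. d dvd n}" and ?S = "{n. n mod d = s}" and ?S' = "{n. n mod d = d - s}"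
  have "{n. n mod d \<in> {0, s, d - s}} = ?Z \<union> (?S' \<union> ?S)"
    by auto
  moreover have "euler_prod (?Z \<union> (?S' \<union> ?S)) = euler_prod ?Z * euler_prod (?S' \<union> ?S)"
    using assms by (intro euler_prod_union) auto
  moreover have "euler_prod (?S' \<union> ?S) = euler_prod ?S' * euler_prod ?S"
    using assms by (intro euler_prod_union) auto
  ultimately have prod:
      "euler_prod {n. n mod d \<in> {0, s, d - s}} = euler d * (euler_prod ?S' * euler_prod ?S)"
    by (simp only: euler_def)
  have S: "fps_cong n (euler_prod ?S) B"
    unfolding B_def using assms by (intro fps_cong_residue_class) (auto simp: N_def)
  have "d * Suc i - s = d * i + (d - s)" for i
    using assms by simp
  hence S': "fps_cong n (euler_prod ?S') A"
    unfolding A_def using assms fps_cong_residue_class[of "d - s" d n N] by (simp add: N_def)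
  have "fps_cong n (euler_prod {n. n mod d \<in> {0, s, d - s}}) (euler d * (A * B))"
    unfolding prod by (intro fps_cong_mult S S' fps_cong_refl)
  hence "fps_nth (euler_prod {n. n mod d \<in> {0, s, d - s}}) n = fps_nth (euler d * (A * B)) n"
    by (rule fps_cong_nth) simp
  also have "euler d * (A * B) = (\<Sum>k\<le>N + N. euler d * g k * fps_X ^ e k)"
    unfolding AB sum_distrib_left by (simp add: mult.assoc)
  also have "fps_nth \<dots> n = (\<Sum>k\<le>N + N. fps_nth (euler d * g k * fps_X ^ e k) n)"
    by (simp add: fps_sum_nth)
  also have "\<dots> = (\<Sum>k\<le>N + N. if e k = n then 1 else 0)"
  proof (intro sum.cong refl)
    fix k assume k: "k \<in> {..N + N}"
    show "fps_nth (euler d * g k * fps_X ^ e k) n = (if e k = n then 1 else 0)"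
    proof (cases "n < e k")
      case False
      hence "\<bar>int k - int N\<bar> \<le> int n"
        using abs_le_e[of k] by linarith
      hence "n \<le> k" "n \<le> N + N - k"
        by (auto simp: N_def)
      hence "fps_cong n (euler d * g k) 1"
        unfolding g_def using assms k by (intro fps_cong_euler_gauss_binomial) auto
      hence "fps_nth (euler d * g k) (n - e k) = fps_nth 1 (n - e k)"
        by (rule fps_cong_nth) simp
      thus ?thesis
        using False by (auto simp: fps_X_power_mult_right_nth)
    qed (auto simp: fps_X_power_mult_right_nth)
  qed
  also have "\<dots> = of_nat (card {k \<in> {..N + N}. e k = n})"
    by (simp add: sum.If_cases Int_def)
  also have "card {k \<in> {..N + N}. e k = n} = card {j. jacobi_exponent d s j = int n}"
  proof (rule bij_betw_same_card[of "\<lambda>k. int k - int N"], rule bij_betwI')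
    fix j assume j: "j \<in> {j. jacobi_exponent d s j = int n}"
    hence "\<bar>j\<bar> \<le> int n"
      using abs_le_jacobi_exponent[OF assms(1,2), of j] by simp
    define k where "k = nat (j + int N)"
    have jk: "j = int k - int N" and "k \<le> N + N"
      using \<open>\<bar>j\<bar> \<le> int n\<close> by (auto simp: N_def k_def)
    moreover have "e k = n"
      using j unfolding e_def jk by simp
    ultimately show "\<exists>k\<in>{k \<in> {..N + N}. e k = n}. j = int k - int N"
      by blast
  qed (auto simp flip: int_e)
  finally show "fps_nth (euler_prod {n. n mod d \<in> {0, s, d - s}}) n =
      fps_nth (count_fps UNIV (jacobi_exponent d s)) n"
    by (simp add: count_fps_def)
qed

section \<open>Generating functions of parities of fibre sizes\<close>

text \<open>Nonnegativity is required because \<open>count_fps\<close> sees only fibres over natural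
  numbers; a shift or a sum could otherwise bring unseen points into view.\<close>

definition admissible :: "'a set \<Rightarrow> ('a \<Rightarrow> int) \<Rightarrow> bool" where
  "admissible A Q \<longleftrightarrow> (\<forall>x\<in>A. 0 \<le> Q x) \<and> (\<forall>n. finite {x \<in> A. Q x = n})"

lemma admissible_subset:
  assumes "admissible B Q" "A \<subseteq> B"
  shows "admissible A Q"
proof -
  have "finite {x \<in> A. Q x = n}" for n
    by (rule finite_subset[of _ "{x \<in> B. Q x = n}"]) (use assms in \<open>auto simp: admissible_def\<close>)
  thus ?thesis
    using assms by (auto simp: admissible_def)
qed

lemma bij_betw_fibres:
  assumes "bij_betw h A B" "\<And>x. x \<in> A \<Longrightarrow> R (h x) = Q x"
  shows "bij_betw h {x \<in> A. Q x = n} {y \<in> B. R y = n}"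
proof (rule bij_betwI')
  fix y assume y: "y \<in> {y \<in> B. R y = n}"
  then obtain x where "x \<in> A" "y = h x"
    using assms(1) by (auto simp: bij_betw_def)
  thus "\<exists>x\<in>{x \<in> A. Q x = n}. y = h x"
    using y assms(2)[of x] by auto
next
  fix x y assume "x \<in> {x \<in> A. Q x = n}" "y \<in> {x \<in> A. Q x = n}"
  thus "(h x = h y) = (x = y)"
    using assms(1) by (auto simp: bij_betw_def inj_on_def)
next
  fix x assume "x \<in> {x \<in> A. Q x = n}"
  thus "h x \<in> {y \<in> B. R y = n}"
    using assms(1) assms(2)[of x] by (auto simp: bij_betw_def)
qed

lemma admissible_reindex:
  assumes "bij_betw h A B" "\<And>x. x \<in> A \<Longrightarrow> R (h x) = Q x"
  shows "admissible B R \<longleftrightarrow> admissible A Q"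
proof -
  have "(\<forall>y\<in>B. 0 \<le> R y) \<longleftrightarrow> (\<forall>x\<in>A. 0 \<le> Q x)"
    using assms by (auto simp: bij_betw_def)
  moreover have "finite {y \<in> B. R y = n} \<longleftrightarrow> finite {x \<in> A. Q x = n}" for n
    using bij_betw_finite[OF bij_betw_fibres[of h A B R Q, OF assms]] by simp
  ultimately show ?thesis
    by (simp add: admissible_def)
qed

lemma count_fps_reindex:
  assumes "bij_betw h A B" "\<And>x. x \<in> A \<Longrightarrow> R (h x) = Q x"
  shows "count_fps B R = count_fps A Q"
  using bij_betw_same_card[OF bij_betw_fibres[of h A B R Q, OF assms]] by (simp add: count_fps_def)

lemma count_fps_union:
  assumes "admissible (A \<union> B) Q" "A \<inter> B = {}"
  shows "count_fps (A \<union> B) Q = count_fps A Q + count_fps B Q"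
proof (rule fps_ext)
  fix n :: nat
  have "{x \<in> A \<union> B. Q x = int n} = {x \<in> A. Q x = int n} \<union> {x \<in> B. Q x = int n}"
    by auto
  moreover have "finite {x \<in> A \<union> B. Q x = int n}"
    using assms by (simp add: admissible_def)
  ultimately have "card {x \<in> A \<union> B. Q x = int n} = card {x \<in> A. Q x = int n} + card {x \<in> B. Q x = int n}"
    using assms(2) by (subst card_Un_disjoint [symmetric]) auto
  thus "fps_nth (count_fps (A \<union> B) Q) n = fps_nth (count_fps A Q + count_fps B Q) n"
    by (simp add: count_fps_def)
qed

lemma count_fps_free_involution:
  assumes "\<And>x. x \<in> A \<Longrightarrow> \<tau> x \<in> A" "\<And>x. x \<in> A \<Longrightarrow> \<tau> (\<tau> x) = x" "\<And>x. x \<in> A \<Longrightarrow> \<tau> x \<noteq> x"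
    and "\<And>x. x \<in> A \<Longrightarrow> Q (\<tau> x) = Q x"
  shows "count_fps A Q = 0"
proof (rule fps_ext)
  fix n
  have "(\<Sum>x | x \<in> A \<and> Q x = int n. 1 :: bit) = 0"
    by (rule sum_involution_eq_0[of _ _ \<tau>]) (use assms in auto)
  thus "fps_nth (count_fps A Q) n = fps_nth 0 n"
    by (simp add: count_fps_def)
qed

text \<open>Points moved by the involution pair off within their fibres, so modulo 2 only fixed
  points count.\<close>

lemma count_fps_involution:
  assumes "admissible A Q"
    and "\<And>x. x \<in> A \<Longrightarrow> \<tau> x \<in> A" "\<And>x. x \<in> A \<Longrightarrow> \<tau> (\<tau> x) = x" "\<And>x. x \<in> A \<Longrightarrow> Q (\<tau> x) = Q x"
  shows "count_fps A Q = count_fps {x \<in> A. \<tau> x = x} Q"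
proof -
  let ?F = "{x \<in> A. \<tau> x = x}" and ?G = "{x \<in> A. \<tau> x \<noteq> x}"
  have A: "A = ?F \<union> ?G" by auto
  have "count_fps (?F \<union> ?G) Q = count_fps ?F Q + count_fps ?G Q"
    using assms(1) A by (intro count_fps_union) auto
  also have "count_fps ?G Q = 0"
    using assms by (intro count_fps_free_involution[of _ \<tau>]) auto
  finally show ?thesis
    using A by simp
qed

lemma count_fps_mult:
  fixes Q :: "'a \<Rightarrow> int" and R :: "'b \<Rightarrow> int"
  assumes "admissible A Q" "admissible B R"
  shows admissible_times: "admissible (A \<times> B) (\<lambda>(x, y). Q x + R y)"
    and "count_fps A Q * count_fps B R = count_fps (A \<times> B) (\<lambda>(x, y). Q x + R y)"
proof -
  let ?F = "\<lambda>i. {x \<in> A. Q x = i}" and ?G = "\<lambda>i. {y \<in> B. R y = i}"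
  have fin: "finite (?F i)" "finite (?G i)" for i
    using assms by (auto simp: admissible_def)
  have *: "{z \<in> A \<times> B. (\<lambda>(x, y). Q x + R y) z = int n} = (\<Union>i\<in>{0..n}. ?F (int i) \<times> ?G (int (n - i)))" for n
  proof (intro equalityI subsetI)
    fix z assume z: "z \<in> {z \<in> A \<times> B. (\<lambda>(x, y). Q x + R y) z = int n}"
    then obtain x y where xy: "z = (x, y)" "x \<in> A" "y \<in> B" "Q x + R y = int n"
      by auto
    hence "0 \<le> Q x" "0 \<le> R y"
      using assms by (auto simp: admissible_def)
    hence "z \<in> ?F (int (nat (Q x))) \<times> ?G (int (n - nat (Q x)))" "nat (Q x) \<in> {0..n}"
      using xy by auto
    thus "z \<in> (\<Union>i\<in>{0..n}. ?F (int i) \<times> ?G (int (n - i)))"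
      by blast
  qed auto
  have nonneg: "0 \<le> (\<lambda>(x, y). Q x + R y) z" if "z \<in> A \<times> B" for z
    using that assms by (auto simp: admissible_def)
  have "finite {z \<in> A \<times> B. (\<lambda>(x, y). Q x + R y) z = n}" for n
  proof (cases "n \<ge> 0")
    case True
    thus ?thesis
      using *[of "nat n"] fin by simp
  next
    case False
    hence "{z \<in> A \<times> B. (\<lambda>(x, y). Q x + R y) z = n} = {}"
      using nonneg by force
    thus ?thesis by (metis finite.emptyI)
  qed
  thus "admissible (A \<times> B) (\<lambda>(x, y). Q x + R y)"
    using nonneg by (simp add: admissible_def)
  show "count_fps A Q * count_fps B R = count_fps (A \<times> B) (\<lambda>(x, y). Q x + R y)"
  proof (rule fps_ext)
    fix n
    have "card (\<Union>i\<in>{0..n}. ?F (int i) \<times> ?G (int (n - i))) =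
        (\<Sum>i=0..n. card (?F (int i)) * card (?G (int (n - i))))"
      using fin by (subst card_UN_disjoint) auto
    thus "fps_nth (count_fps A Q * count_fps B R) n =
        fps_nth (count_fps (A \<times> B) (\<lambda>(x, y). Q x + R y)) n"
      unfolding count_fps_def fps_mult_nth fps_nth_Abs_fps * by simp
  qed
qed

lemma count_fps_shift:
  assumes "admissible A Q"
  shows "count_fps A (\<lambda>x. Q x + int j) = fps_X ^ j * count_fps A Q"
proof (rule fps_ext)
  fix n
  show "fps_nth (count_fps A (\<lambda>x. Q x + int j)) n = fps_nth (fps_X ^ j * count_fps A Q) n"
  proof (cases "n < j")
    case True
    hence "{x \<in> A. Q x + int j = int n} = {}"
      using assms by (force simp: admissible_def)
    thus ?thesis
      using True by (simp only: count_fps_def fps_nth_Abs_fps card.empty of_nat_0 fps_X_power_mult_nth if_True)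
  next
    case False
    hence "{x \<in> A. Q x + int j = int n} = {x \<in> A. Q x = int (n - j)}"
      by auto
    thus ?thesis
      using False by (simp add: count_fps_def fps_X_power_mult_nth)
  qed
qed

lemma admissible_jacobi_exponent:
  assumes "0 < s" "s < d"
  shows "admissible UNIV (jacobi_exponent d s)"
proof -
  have "0 \<le> jacobi_exponent d s k" for k
    using abs_le_jacobi_exponent[OF assms, of k] by simp
  moreover have "{k. jacobi_exponent d s k = n} \<subseteq> {-n..n}" for n
  proof
    fix k assume "k \<in> {k. jacobi_exponent d s k = n}"
    thus "k \<in> {-n..n}"
      using abs_le_jacobi_exponent[OF assms, of k] by auto
  qed
  hence "finite {k. jacobi_exponent d s k = n}" for n
    by (rule finite_subset) simp
  ultimately show ?thesis
    by (simp add: admissible_def)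
qed

section \<open>Theta expansions\<close>

lemma euler_neq_0 [simp]: "euler m \<noteq> 0"
  by (simp add: euler_def)

lemma fps_nth_euler_0 [simp]: "fps_nth (euler m) 0 = 1"
  by (simp add: euler_def)

lemma euler_double: "euler (2 * m) = (euler m)\<^sup>2"
proof -
  have "{n. 2 * m dvd n} = (*) 2 ` {n. m dvd n}"
  proof (intro equalityI subsetI)
    fix n assume "n \<in> {n. 2 * m dvd n}"
    hence "2 * m dvd n" by simp
    then obtain k where "n = 2 * m * k" by (rule dvdE)
    hence "n = 2 * (m * k)" by (simp only: mult.assoc)
    thus "n \<in> (*) 2 ` {n. m dvd n}" by simp
  qed auto
  thus ?thesis
    by (simp add: euler_def euler_prod_double)
qed

text \<open>With \<open>d = 3 * m\<close> and \<open>s = m\<close> the three residue classes are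
  exactly the multiples of \<open>m\<close>; this is the pentagonal number theorem modulo 2.\<close>

lemma euler_pentagonal: "0 < m \<Longrightarrow> euler m = count_fps UNIV (jacobi_exponent (3 * m) m)"
proof -
  assume m: "0 < m"
  have "{n. n mod (3 * m) \<in> {0, m, 3 * m - m}} = {n. m dvd n}"
  proof (intro equalityI subsetI)
    fix n assume "n \<in> {n. n mod (3 * m) \<in> {0, m, 3 * m - m}}"
    hence "m dvd n mod (3 * m)" by auto
    thus "n \<in> {n. m dvd n}" by (simp add: dvd_mod_iff)
  next
    fix n assume "n \<in> {n. m dvd n}"
    then obtain j where n: "n = m * j" by auto
    have "j mod 3 = 0 \<or> j mod 3 = 1 \<or> j mod 3 = 2" by linarith
    moreover have "n mod (3 * m) = m * (j mod 3)"
      unfolding n by (simp only: mod_mult_mult1 mult.commute[of 3 m])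
    ultimately show "n \<in> {n. n mod (3 * m) \<in> {0, m, 3 * m - m}}" by auto
  qed
  thus ?thesis
    using jacobi_triple_product_mod_2[of m "3 * m"] m by (simp add: euler_def)
qed

text \<open>Over all integers \<open>k\<close> this takes each triangular number exactly once. The
  relation \<open>8 * triangular k + 1 = (4 * k + 1)^2\<close> is the source of the odd squares
  below.\<close>

definition triangular :: "int \<Rightarrow> int" where
  "triangular k = k * (2 * k + 1)"

lemma jacobi_exponent_triangular: "jacobi_exponent (4 * m) (3 * m) = (\<lambda>k. int m * triangular k)"
proof
  fix k
  show "jacobi_exponent (4 * m) (3 * m) k = int m * triangular k"
    using two_jacobi_exponent[of "4 * m" "3 * m" k] by (simp add: triangular_def algebra_simps)
qed

lemma admissible_triangular: "0 < m \<Longrightarrow> admissible UNIV (\<lambda>k. int m * triangular k)"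
  using admissible_jacobi_exponent[of "3 * m" "4 * m"] by (simp add: jacobi_exponent_triangular)

text \<open>Write \<open>f = euler m\<close>, and \<open>S\<close>, \<open>T\<close> for the
  products over \<open>?S\<close>, \<open>?T\<close>. Sorting residues modulo \<open>4 * m\<close>
  gives \<open>f = S T\<close> and \<open>f^2 = T f^4\<close>, whence \<open>f^5 = S f^2\<close> and
  \<open>f^3 = S\<close>, which is a theta series by the triple product.\<close>

lemma euler_cubed:
  assumes "0 < m"
  shows "(euler m) ^ 3 = count_fps UNIV (\<lambda>k. int m * triangular k)"
proof -
  let ?S = "{n. n mod (4 * m) \<in> {0, 3 * m, 4 * m - 3 * m}}" and ?T = "{n. n mod (4 * m) = 2 * m}"
  have dvd_iff: "m dvd n \<longleftrightarrow> n mod (4 * m) \<in> {0, m, 2 * m, 3 * m}"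
    "2 * m dvd n \<longleftrightarrow> n mod (4 * m) \<in> {0, 2 * m}" for n
  proof -
    have lt: "n mod (4 * m) < 4 * m"
      using assms by simp
    have "m dvd r \<longleftrightarrow> r \<in> {0, m, 2 * m, 3 * m}" if "r < 4 * m" for r
    proof
      assume "m dvd r"
      then obtain j where j: "r = m * j" by auto
      with that have "j < 4" by simp
      hence "j = 0 \<or> j = 1 \<or> j = 2 \<or> j = 3" by linarith
      thus "r \<in> {0, m, 2 * m, 3 * m}" using j by auto
    qed auto
    from this[OF lt] show "m dvd n \<longleftrightarrow> n mod (4 * m) \<in> {0, m, 2 * m, 3 * m}"
      by (simp only: dvd_mod_iff dvd_triv_right)
    have "2 * m dvd r \<longleftrightarrow> r \<in> {0, 2 * m}" if "r < 4 * m" for r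
    proof
      assume "2 * m dvd r"
      then obtain j where j: "r = 2 * m * j" by auto
      with that have "j < 2" by simp
      hence "j = 0 \<or> j = 1" by linarith
      thus "r \<in> {0, 2 * m}" using j by auto
    qed auto
    from this[OF lt] show "2 * m dvd n \<longleftrightarrow> n mod (4 * m) \<in> {0, 2 * m}"
      using dvd_mod_iff[of "2 * m" "4 * m" n] by simp
  qed
  have "{n. m dvd n} = ?S \<union> ?T"
    unfolding dvd_iff by auto
  moreover have "euler_prod (?S \<union> ?T) = euler_prod ?S * euler_prod ?T"
    using assms by (intro euler_prod_union) auto
  ultimately have 1: "euler m = euler_prod ?S * euler_prod ?T"
    by (simp only: euler_def)
  have "{n. 2 * m dvd n} = ?T \<union> {n. 4 * m dvd n}"
    unfolding dvd_iff by auto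
  moreover have "euler_prod (?T \<union> {n. 4 * m dvd n}) = euler_prod ?T * euler_prod {n. 4 * m dvd n}"
    using assms by (intro euler_prod_union) auto
  ultimately have "euler (2 * m) = euler_prod ?T * euler (2 * (2 * m))"
    by (simp add: euler_def)
  hence 2: "(euler m)\<^sup>2 = euler_prod ?T * (euler m) ^ 4"
    unfolding euler_double by (simp flip: power_mult)
  have "(euler m) ^ 3 * (euler m)\<^sup>2 = euler m * (euler m) ^ 4"
    by (simp add: eval_nat_numeral)
  also have "\<dots> = euler_prod ?S * euler_prod ?T * (euler m) ^ 4"
    by (rule arg_cong[OF 1, of "\<lambda>x. x * (euler m) ^ 4"])
  also have "\<dots> = euler_prod ?S * (euler m)\<^sup>2"
    unfolding 2 by (rule mult.assoc)
  finally have "(euler m) ^ 3 = euler_prod ?S"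
    by (rule mult_right_cancel[THEN iffD1, rotated]) simp
  thus ?thesis
    using jacobi_triple_product_mod_2[of "3 * m" "4 * m"] assms
    by (simp add: jacobi_exponent_triangular)
qed

text \<open>Let \<open>U\<close>, \<open>V\<close> be the products over the residues 1, 5 and 2, 4
  modulo 6. Then \<open>f\<^sub>1 = U V f\<^sub>3\<close> and
  \<open>f\<^sub>1^2 = V f\<^sub>3^2\<close>, while the triple product for \<open>d = 6\<close>,
  \<open>s = 5\<close> is \<open>U f\<^sub>3^2\<close>; eliminating \<open>U\<close> and
  \<open>V\<close> leaves the claim.\<close>

lemma euler_3_cubed: "(euler 3) ^ 3 = euler 1 * count_fps UNIV (jacobi_exponent 6 5)"
proof -
  let ?U = "{n::nat. n mod 6 \<in> {1, 5}}" and ?V = "{n::nat. n mod 6 \<in> {2, 4}}"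
  let ?S = "{n::nat. n mod 6 \<in> {0, 5, 6 - 5}}"
  have "{n. 1 dvd n} = ?U \<union> (?V \<union> {n. 3 dvd n})"
    by (auto; presburger)
  moreover have "euler_prod (?V \<union> {n. 3 dvd n}) = euler_prod ?V * euler 3"
    unfolding euler_def by (intro euler_prod_union) (auto; presburger)
  moreover have "euler_prod (?U \<union> (?V \<union> {n. 3 dvd n})) = euler_prod ?U * euler_prod (?V \<union> {n. 3 dvd n})"
    by (intro euler_prod_union) (auto; presburger)
  ultimately have 1: "euler 1 = euler_prod ?U * (euler_prod ?V * euler 3)"
    by (simp add: euler_def)
  have "{n. 2 dvd n} = ?V \<union> {n. 6 dvd n}"
    by (auto; presburger)
  moreover have "euler_prod (?V \<union> {n. 6 dvd n}) = euler_prod ?V * euler 6"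
    unfolding euler_def by (intro euler_prod_union) (auto; presburger)
  ultimately have 2: "(euler 1)\<^sup>2 = euler_prod ?V * (euler 3)\<^sup>2"
    using euler_double[of 1] euler_double[of 3] by (simp add: euler_def)
  have "?S = ?U \<union> {n. 6 dvd n}"
    by (auto; presburger)
  moreover have "euler_prod (?U \<union> {n. 6 dvd n}) = euler_prod ?U * euler 6"
    unfolding euler_def by (intro euler_prod_union) (auto; presburger)
  ultimately have 3: "euler_prod ?S = euler_prod ?U * (euler 3)\<^sup>2"
    using euler_double[of 3] by simp
  have "euler 1 * (euler 1 * euler_prod ?S) = (euler 1)\<^sup>2 * euler_prod ?U * (euler 3)\<^sup>2"
    unfolding 3 by (simp add: power2_eq_square mult_ac)
  also have "\<dots> = (euler_prod ?U * (euler_prod ?V * euler 3)) * (euler 3) ^ 3"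
    unfolding 2 by (simp add: power_numeral_reduce mult_ac)
  also have "\<dots> = euler 1 * (euler 3) ^ 3"
    by (simp only: 1 [symmetric])
  finally have "euler 1 * euler_prod ?S = (euler 3) ^ 3"
    by simp
  thus ?thesis
    using jacobi_triple_product_mod_2[of 5 6] by simp
qed

section \<open>Two theta identities\<close>

text \<open>On \<open>D\<close> exactly one coordinate is odd, and negating the even one preserves
  \<open>a + b\<close> modulo 4. At a fixed point the even coordinate is 0, so the odd one is 1
  modulo 4.\<close>

lemma count_fps_sign_changes:
  fixes R :: "int \<times> int \<Rightarrow> int"
  defines "D \<equiv> {(a, b). (a + b) mod 4 = 1}"
  assumes "admissible D R" "\<And>a b. R (a, -b) = R (a, b)" "\<And>a b. R (-a, b) = R (a, b)"
  shows "count_fps D R = count_fps UNIV (\<lambda>t. R (4 * t + 1, 0)) + count_fps UNIV (\<lambda>t. R (0, 4 * t + 1))"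
proof -
  define \<tau> :: "int \<times> int \<Rightarrow> int \<times> int" where
    "\<tau> = (\<lambda>(a, b). if even b then (a, -b) else (-a, b))"
  let ?F = "{(a, b). a mod 4 = (1::int) \<and> b = (0::int)}" and ?G = "{(a, b). a = (0::int) \<and> b mod 4 = (1::int)}"
  have flip: "(a - b) mod 4 = 1" if "(a + b) mod 4 = 1" "even b" for a b :: int
    using that by presburger
  have flip': "(b - a) mod 4 = 1" if "(a + b) mod 4 = 1" "odd b" for a b :: int
    using that by presburger
  have "count_fps D R = count_fps {x \<in> D. \<tau> x = x} R"
  proof (rule count_fps_involution[OF assms(2)])
    fix x assume "x \<in> D"
    then obtain a b where x: "x = (a, b)" "(a + b) mod 4 = 1"
      by (auto simp: D_def)
    show "\<tau> x \<in> D"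
      using flip[OF x(2)] flip'[OF x(2)] by (auto simp: \<tau>_def D_def x(1))
    show "\<tau> (\<tau> x) = x" "R (\<tau> x) = R x"
      by (auto simp: \<tau>_def x(1) assms(3,4))
  qed
  also have "{x \<in> D. \<tau> x = x} = ?F \<union> ?G"
    by (auto simp: \<tau>_def D_def split: if_splits) presburger+
  also have "count_fps (?F \<union> ?G) R = count_fps ?F R + count_fps ?G R"
    by (intro count_fps_union admissible_subset[OF assms(2)]) (auto simp: D_def)
  also have "count_fps ?F R = count_fps UNIV (\<lambda>t. R (4 * t + 1, 0))"
  proof (rule count_fps_reindex)
    show "bij_betw (\<lambda>t. (4 * t + 1, 0)) UNIV ?F"
      by (rule bij_betw_byWitness[of _ "\<lambda>(a, b). a div 4"]) (auto, presburger+)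
  qed simp
  also have "count_fps ?G R = count_fps UNIV (\<lambda>t. R (0, 4 * t + 1))"
  proof (rule count_fps_reindex)
    show "bij_betw (\<lambda>t. (0, 4 * t + 1)) UNIV ?G"
      by (rule bij_betw_byWitness[of _ "\<lambda>(a, b). b div 4"]) (auto, presburger+)
  qed simp
  finally show ?thesis .
qed

lemma euler_cubed_mult:
  assumes "0 < m" "0 < m'"
  shows "(euler m) ^ 3 * (euler m') ^ 3 =
      count_fps UNIV (\<lambda>(k, l). int m * triangular k + int m' * triangular l)"
    and "admissible UNIV (\<lambda>(k, l). int m * triangular k + int m' * triangular l)"
proof -
  note adm = admissible_triangular[OF assms(1)] admissible_triangular[OF assms(2)]
  show "(euler m) ^ 3 * (euler m') ^ 3 =
      count_fps UNIV (\<lambda>(k, l). int m * triangular k + int m' * triangular l)"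
    using count_fps_mult(2)[OF adm] assms by (simp add: euler_cubed)
  show "admissible UNIV (\<lambda>(k, l). int m * triangular k + int m' * triangular l)"
    using count_fps_mult(1)[OF adm] by simp
qed

text \<open>
  Put \<open>x = 4 k + 1\<close> and \<open>y = 4 l + 1\<close>. The left-hand side counts representations by
  \<open>x\<^sup>2 + 3 y\<^sup>2\<close>. Multiplying \<open>x + y \<surd>-3\<close> by the unit \<open>(1 - \<surd>-3) / 2\<close> gives
  \<open>2 (a + b \<surd>-3)\<close> with \<open>a + b\<close> odd, and sign changes of \<open>a\<close> and \<open>b\<close> pair off all
  representations but those on the axes.
\<close>

lemma euler_1_3:
  "(euler 1) ^ 3 * (euler 3) ^ 3 = (euler 4) ^ 3 + fps_X * (euler 12) ^ 3"
proof -
  define Q :: "int \<times> int \<Rightarrow> int" where "Q = (\<lambda>(k, l). int 1 * triangular k + int 3 * triangular l)"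
  \<comment> \<open>This is \<open>Q\<close> in the new coordinates, as
    \<open>8 Q + 4 = x^2 + 3 y^2 = 4 (a^2 + 3 b^2)\<close>. Since \<open>a + b = 4 l + 1\<close>,
    the inverse of \<open>h\<close> recovers \<open>l\<close> as
    \<open>(a + b) div 4\<close>.\<close>
  define R :: "int \<times> int \<Rightarrow> int" where "R = (\<lambda>(a, b). (a\<^sup>2 + 3 * b\<^sup>2 - 1) div 2)"
  define h :: "int \<times> int \<Rightarrow> int \<times> int" where "h = (\<lambda>(k, l). (k + 3 * l + 1, l - k))"
  let ?D = "{(a, b). (a + b) mod 4 = (1::int)}"
  have h: "bij_betw h UNIV ?D"
  proof (rule bij_betw_byWitness[of _ "\<lambda>(a, b). ((a + b) div 4 - b, (a + b) div 4)"])
    show "\<forall>y\<in>?D. h (case y of (a, b) \<Rightarrow> ((a + b) div 4 - b, (a + b) div 4)) = y"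
      unfolding h_def by (auto; presburger)
    show "\<forall>x\<in>UNIV. (case h x of (a, b) \<Rightarrow> ((a + b) div 4 - b, (a + b) div 4)) = x"
      unfolding h_def by (auto; presburger)
    show "h ` UNIV \<subseteq> ?D"
      unfolding h_def by (auto; presburger)
  qed auto
  have Rh: "R (h x) = Q x" for x
  proof (cases x)
    case (Pair k l)
    have "(k + 3 * l + 1)\<^sup>2 + 3 * (l - k)\<^sup>2 - 1 = 2 * (triangular k + 3 * triangular l)"
      by (simp add: triangular_def power2_eq_square algebra_simps)
    thus ?thesis
      unfolding Pair R_def h_def Q_def by simp
  qed
  have adm: "admissible ?D R"
    using euler_cubed_mult(2)[of 1 3] admissible_reindex[of h UNIV ?D R Q, OF h Rh] by (simp add: Q_def)
  have R1: "R (4 * t + 1, 0) = int 4 * triangular t" for t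
  proof -
    have "(4 * t + 1)\<^sup>2 + 3 * 0\<^sup>2 - 1 = 2 * (4 * triangular t)"
      by (simp add: triangular_def power2_eq_square algebra_simps)
    thus ?thesis unfolding R_def prod.case by simp
  qed
  have R2: "R (0, 4 * t + 1) = int 12 * triangular t + int 1" for t
  proof -
    have "0\<^sup>2 + 3 * (4 * t + 1)\<^sup>2 - 1 = 2 * (12 * triangular t + 1)"
      by (simp add: triangular_def power2_eq_square algebra_simps)
    thus ?thesis unfolding R_def prod.case by simp
  qed
  have "(euler 1) ^ 3 * (euler 3) ^ 3 = count_fps UNIV Q"
    using euler_cubed_mult(1)[of 1 3] by (simp only: Q_def zero_less_one zero_less_numeral)
  also have "\<dots> = count_fps ?D R"
    by (rule count_fps_reindex[of h UNIV ?D R Q, OF h Rh, symmetric])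
  also have "\<dots> = count_fps UNIV (\<lambda>t. R (4 * t + 1, 0)) + count_fps UNIV (\<lambda>t. R (0, 4 * t + 1))"
    by (rule count_fps_sign_changes[OF adm]) (simp_all add: R_def)
  also have "\<dots> = (euler 4) ^ 3 + fps_X ^ 1 * (euler 12) ^ 3"
    unfolding R1 R2 by (subst count_fps_shift) (simp_all only: admissible_triangular euler_cubed zero_less_numeral)
  finally show ?thesis by simp
qed

text \<open>
  Now the form is \<open>x\<^sup>2 + 7 y\<^sup>2\<close>, and \<open>(x + y \<surd>-7) / 2\<close> is divided by the prime
  \<open>(1 + \<surd>-7) / 2\<close> above 2. Quotients \<open>(a + b \<surd>-7) / 2\<close> with \<open>a\<close> and \<open>b\<close> odd
  give the middle term on the right, those with \<open>a\<close> and \<open>b\<close> even the two others.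
\<close>

lemma euler_1_7_cubes:
  assumes "0 < m"
  shows "(euler m) ^ 3 * (euler (7 * m)) ^ 3 =
    (euler (8 * m)) ^ 3 + fps_X ^ m * ((euler (2 * m)) ^ 3 * (euler (14 * m)) ^ 3)
    + fps_X ^ (6 * m) * (euler (56 * m)) ^ 3"
proof -
  define Q :: "int \<times> int \<Rightarrow> int" where "Q = (\<lambda>(k, l). int m * triangular k + int (7 * m) * triangular l)"
  define Q' :: "int \<times> int \<Rightarrow> int" where "Q' = (\<lambda>(k, l). int (2 * m) * triangular k + int (14 * m) * triangular l)"
  define S :: "int \<times> int \<Rightarrow> int" where "S = (\<lambda>(a, b). int m * ((a\<^sup>2 + 7 * b\<^sup>2) div 4 - 1))"
  define R :: "int \<times> int \<Rightarrow> int" where "R = (\<lambda>(a, b). int m * (a\<^sup>2 + 7 * b\<^sup>2 - 1))"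
  \<comment> \<open>For \<open>x = 4 k + 1\<close> and \<open>y = 4 l + 1\<close> the quotient has
    \<open>a = (x + 7 y) / 4\<close> and \<open>b = (y - x) / 4\<close>, so that
    \<open>a + b = 8 l + 2\<close>.\<close>
  define h :: "int \<times> int \<Rightarrow> int \<times> int" where "h = (\<lambda>(k, l). (k + 7 * l + 2, l - k))"
  let ?D = "{(a, b). (a + b) mod 8 = (2::int)}"
  let ?E = "{(a, b). (a + b) mod 8 = (2::int) \<and> even a}" and ?O = "{(a, b). (a + b) mod 8 = (2::int) \<and> odd a}"
  let ?D4 = "{(a, b). (a + b) mod 4 = (1::int)}"
  have h: "bij_betw h UNIV ?D"
  proof (rule bij_betw_byWitness[of _ "\<lambda>(a, b). ((a + b) div 8 - b, (a + b) div 8)"])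
    show "\<forall>y\<in>?D. h (case y of (a, b) \<Rightarrow> ((a + b) div 8 - b, (a + b) div 8)) = y"
      unfolding h_def by (auto; presburger)
    show "\<forall>x\<in>UNIV. (case h x of (a, b) \<Rightarrow> ((a + b) div 8 - b, (a + b) div 8)) = x"
      unfolding h_def by (auto; presburger)
    show "h ` UNIV \<subseteq> ?D"
      unfolding h_def by (auto; presburger)
  qed auto
  have Sh: "S (h x) = Q x" for x
  proof (cases x)
    case (Pair k l)
    have "(k + 7 * l + 2)\<^sup>2 + 7 * (l - k)\<^sup>2 = 4 * (triangular k + 7 * triangular l + 1)"
      by (simp add: triangular_def power2_eq_square algebra_simps)
    hence "((k + 7 * l + 2)\<^sup>2 + 7 * (l - k)\<^sup>2) div 4 = triangular k + 7 * triangular l + 1"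
      by simp
    thus ?thesis
      unfolding Pair S_def h_def Q_def by (simp add: algebra_simps)
  qed
  have adm: "admissible ?D S"
    using euler_cubed_mult(2)[of m "7 * m"] admissible_reindex[of h UNIV ?D S Q, OF h Sh] assms by (simp add: Q_def)
  have DEO: "?D = ?E \<union> ?O" by auto

  define g :: "int \<times> int \<Rightarrow> int \<times> int" where "g = (\<lambda>(a, b). (2 * a, 2 * b))"
  have g: "bij_betw g ?D4 ?E"
    unfolding g_def
    by (rule bij_betw_byWitness[of _ "\<lambda>(a, b). (a div 2, b div 2)"]) (auto; presburger)+
  have Sg: "S (g x) = R x" for x
  proof (cases x)
    case (Pair a b)
    have "(2 * a)\<^sup>2 + 7 * (2 * b)\<^sup>2 = 4 * (a\<^sup>2 + 7 * b\<^sup>2)"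
      by (simp add: power_mult_distrib)
    thus ?thesis
      unfolding Pair S_def R_def g_def prod.case by simp
  qed
  have "admissible ?E S"
    by (rule admissible_subset[OF adm]) auto
  hence adm4: "admissible ?D4 R"
    using admissible_reindex[of g ?D4 ?E S R, OF g Sg] by simp
  have R1: "R (4 * t + 1, 0) = int (8 * m) * triangular t" for t
    by (simp add: R_def triangular_def power2_eq_square algebra_simps)
  have R2: "R (0, 4 * t + 1) = int (56 * m) * triangular t + int (6 * m)" for t
    by (simp add: R_def triangular_def power2_eq_square algebra_simps)
  have "count_fps ?E S = count_fps ?D4 R"
    by (rule count_fps_reindex[of g ?D4 ?E S R, OF g Sg])
  also have "\<dots> = count_fps UNIV (\<lambda>t. R (4 * t + 1, 0)) + count_fps UNIV (\<lambda>t. R (0, 4 * t + 1))"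
    by (rule count_fps_sign_changes[OF adm4]) (simp_all add: R_def)
  also have "\<dots> = (euler (8 * m)) ^ 3 + fps_X ^ (6 * m) * (euler (56 * m)) ^ 3"
    unfolding R1 R2 using assms
    by (subst count_fps_shift) (simp_all only: admissible_triangular euler_cubed zero_less_numeral nat_0_less_mult_iff simp_thms)
  finally have E: "count_fps ?E S = (euler (8 * m)) ^ 3 + fps_X ^ (6 * m) * (euler (56 * m)) ^ 3" .

  \<comment> \<open>Odd \<open>a\<close> and \<open>b\<close> with sum 2 modulo 8 are congruent
    modulo 4, so exactly one of \<open>(a, b)\<close> and \<open>(-a, -b)\<close> has the form
    \<open>(4 k + 1, 4 l + 1)\<close>. The parity of \<open>k + l\<close> decides which sign gives
    the sum 2 modulo 8.\<close>
  define f :: "int \<times> int \<Rightarrow> int \<times> int" where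
    "f = (\<lambda>(k, l). if even (k + l) then (4 * k + 1, 4 * l + 1) else (- (4 * k + 1), - (4 * l + 1)))"
  define f' :: "int \<times> int \<Rightarrow> int \<times> int" where
    "f' = (\<lambda>(a, b). if a mod 4 = 1 then (a div 4, b div 4) else ((- a) div 4, (- b) div 4))"
  have f: "bij_betw f UNIV ?O"
  proof (rule bij_betw_byWitness[of _ f'])
    have "(4 * k + 1 + (4 * l + 1)) mod 8 = 2" if "even (k + l)" for k l :: int
      using that by presburger
    moreover have "(- (4 * k + 1) + - (4 * l + 1)) mod 8 = 2" if "odd (k + l)" for k l :: int
      using that by presburger
    moreover have "odd (4 * k + 1)" "odd (- (4 * k + 1))" for k :: int
      by presburger+
    ultimately have "f (k, l) \<in> ?O" for k l
      unfolding f_def prod.case by (cases "even (k + l)") (simp_all only: if_True if_False mem_Collect_eq prod.case simp_thms)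
    from this[of "fst x" "snd x" for x] show "f ` UNIV \<subseteq> ?O"
      by (intro image_subsetI) (simp only: prod.collapse)
    have "(4 * k + 1) mod 4 = 1" "(4 * k + 1) div 4 = k" "(- (4 * k + 1)) mod 4 \<noteq> 1" "(- (- (4 * k + 1))) div 4 = k"
      for k :: int
      by presburger+
    hence "f' (f (k, l)) = (k, l)" for k l
      unfolding f_def f'_def prod.case by (simp only: if_True if_False prod.case split: if_split) simp
    thus "\<forall>x\<in>UNIV. f' (f x) = x"
      by auto
    have "f (f' (a, b)) = (a, b)" if "(a + b) mod 8 = 2" "odd a" for a b
    proof (cases "a mod 4 = 1")
      case True
      hence "4 * (a div 4) + 1 = a" "4 * (b div 4) + 1 = b" "even (a div 4 + b div 4)"
        using that by presburger+
      thus ?thesis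
        using True by (simp only: f_def f'_def prod.case if_True simp_thms)
    next
      case False
      hence "- (4 * ((- a) div 4) + 1) = a" "- (4 * ((- b) div 4) + 1) = b" "odd ((- a) div 4 + (- b) div 4)"
        using that by presburger+
      thus ?thesis
        using False by (simp only: f_def f'_def prod.case if_False simp_thms)
    qed
    thus "\<forall>y\<in>?O. f (f' y) = y"
      by auto
  qed auto
  have Sf: "S (f x) = Q' x + int m" for x
  proof (cases x)
    case (Pair k l)
    have "(4 * k + 1)\<^sup>2 + 7 * (4 * l + 1)\<^sup>2 = 4 * (2 * triangular k + 14 * triangular l + 2)"
      by (simp add: triangular_def power2_eq_square algebra_simps)
    hence "((4 * k + 1)\<^sup>2 + 7 * (4 * l + 1)\<^sup>2) div 4 = 2 * triangular k + 14 * triangular l + 2"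
      by simp
    moreover have "S (f x) = int m * (((4 * k + 1)\<^sup>2 + 7 * (4 * l + 1)\<^sup>2) div 4 - 1)"
      unfolding Pair S_def f_def by (simp only: prod.case if_distrib power2_minus if_cancel)
    ultimately show ?thesis
      unfolding Pair Q'_def by (simp add: algebra_simps)
  qed
  have "count_fps ?O S = count_fps UNIV (\<lambda>x. Q' x + int m)"
    by (rule count_fps_reindex[of f UNIV ?O S, OF f Sf])
  also have "\<dots> = fps_X ^ m * count_fps UNIV Q'"
    using euler_cubed_mult(2)[of "2 * m" "14 * m"] assms by (intro count_fps_shift) (simp add: Q'_def)
  also have "count_fps UNIV Q' = (euler (2 * m)) ^ 3 * (euler (14 * m)) ^ 3"
    using euler_cubed_mult(1)[of "2 * m" "14 * m"] assms by (simp add: Q'_def)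
  finally have O: "count_fps ?O S = fps_X ^ m * ((euler (2 * m)) ^ 3 * (euler (14 * m)) ^ 3)" .

  have "(euler m) ^ 3 * (euler (7 * m)) ^ 3 = count_fps UNIV Q"
    using euler_cubed_mult(1)[of m "7 * m"] assms by (simp add: Q_def)
  also have "\<dots> = count_fps ?D S"
    by (rule count_fps_reindex[of h UNIV ?D S Q, OF h Sh, symmetric])
  also have "\<dots> = count_fps (?E \<union> ?O) S"
    by (simp only: DEO)
  also have "\<dots> = count_fps ?E S + count_fps ?O S"
    by (rule count_fps_union) (use adm DEO in auto)
  finally show ?thesis
    unfolding E O by (simp only: add_ac)
qed

text \<open>
  With \<open>x = f\<^sub>m\<close> and \<open>y = f\<^sub>7\<^sub>m\<close>, the identity \<open>euler_1_7_cubes\<close> says that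
  \<open>S = x\<^sup>8 + q\<^sup>2 y\<^sup>8\<close> and \<open>W = x y + q x\<^sup>4 y\<^sup>4\<close> have the same value of
  \<open>T\<^sup>3 + (q x\<^sup>4 y\<^sup>4)\<^sup>2 T\<close>; the difference is \<open>S - W\<close> times a unit.
\<close>

lemma euler_1_7:
  assumes "0 < m"
  shows "euler m * euler (7 * m) =
    (euler m) ^ 8 + fps_X ^ m * ((euler m) ^ 4 * (euler (7 * m)) ^ 4) + fps_X ^ (2 * m) * (euler (7 * m)) ^ 8"
proof -
  define x y q where "x = euler m" and "y = euler (7 * m)" and "q = (fps_X ^ m :: bit fps)"
  define S W where "S = x ^ 8 + q\<^sup>2 * y ^ 8" and "W = x * y + q * (x ^ 4 * y ^ 4)"
  have two: "2 = (0 :: bit fps)"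
    by (rule bit_fps_2)
  have e: "euler (8 * m) = x ^ 8" "euler (2 * m) = x\<^sup>2" "euler (14 * m) = y\<^sup>2" "euler (56 * m) = y ^ 8"
    using euler_double[of m] euler_double[of "2 * m"] euler_double[of "4 * m"] euler_double[of "7 * m"]
      euler_double[of "14 * m"] euler_double[of "28 * m"]
    by (simp_all add: x_def y_def flip: power_mult)
  have "fps_X ^ (6 * m) = q ^ 6"
    by (simp add: q_def mult.commute flip: power_mult)
  hence "x ^ 3 * y ^ 3 = (x ^ 8) ^ 3 + q * ((x\<^sup>2) ^ 3 * (y\<^sup>2) ^ 3) + q ^ 6 * (y ^ 8) ^ 3"
    using euler_1_7_cubes[OF assms] unfolding e by (simp add: x_def y_def q_def)
  hence cubes: "x ^ 3 * y ^ 3 = x ^ 24 + q * x ^ 6 * y ^ 6 + q ^ 6 * y ^ 24"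
    by (simp add: mult.assoc flip: power_mult)
  have "(S - W) * (S\<^sup>2 + S * W + W\<^sup>2 + (q * (x ^ 4 * y ^ 4))\<^sup>2) = 0"
  proof -
    \<comment> \<open>Given \<open>b^2 = u v\<close>, this is an identity over the integers; its
      last summand is an explicit multiple of 2 and vanishes in characteristic 2.\<close>
    have factor: "(u + v - (a + b)) * ((u + v)\<^sup>2 + (u + v) * (a + b) + (a + b)\<^sup>2 + b\<^sup>2) =
        u ^ 3 + v ^ 3 + a\<^sup>2 * b - a ^ 3 + 2 * (2 * (u * v * (u + v)) - 2 * (a\<^sup>2 * b) - 2 * (a * b\<^sup>2) - b ^ 3)"
      if "b\<^sup>2 = u * v" for u v a b :: "bit fps"
      using that by algebra
    have "(q * (x ^ 4 * y ^ 4))\<^sup>2 = x ^ 8 * (q\<^sup>2 * y ^ 8)"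
      by algebra
    from factor[OF this, of "x * y"] have
      "(S - W) * (S\<^sup>2 + S * W + W\<^sup>2 + (q * (x ^ 4 * y ^ 4))\<^sup>2) =
        (x ^ 8) ^ 3 + (q\<^sup>2 * y ^ 8) ^ 3 + (x * y)\<^sup>2 * (q * (x ^ 4 * y ^ 4)) - (x * y) ^ 3"
      unfolding two S_def W_def by simp
    also have "\<dots> = x ^ 24 + q * x ^ 6 * y ^ 6 + q ^ 6 * y ^ 24 - x ^ 3 * y ^ 3"
      by algebra
    finally show ?thesis
      unfolding cubes by simp
  qed
  moreover have "fps_nth (S\<^sup>2 + S * W + W\<^sup>2 + (q * (x ^ 4 * y ^ 4))\<^sup>2) 0 = 1"
    using assms by (simp add: S_def W_def x_def y_def q_def)
  hence "S\<^sup>2 + S * W + W\<^sup>2 + (q * (x ^ 4 * y ^ 4))\<^sup>2 \<noteq> 0"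
    by (metis fps_zero_nth zero_neq_one)
  ultimately have SW: "S = W"
    by simp
  have "x * y = W + q * (x ^ 4 * y ^ 4)"
    by (simp only: W_def add.assoc bit_fps_add_self add_0_right)
  also have "\<dots> = x ^ 8 + q * (x ^ 4 * y ^ 4) + q\<^sup>2 * y ^ 8"
    by (simp only: SW [symmetric] S_def add_ac)
  finally have "x * y = x ^ 8 + q * (x ^ 4 * y ^ 4) + q\<^sup>2 * y ^ 8" .
  moreover have "q\<^sup>2 = fps_X ^ (2 * m)"
    by (simp add: q_def mult.commute flip: power_mult)
  ultimately show ?thesis
    by (simp add: x_def y_def q_def)
qed

section \<open>The series modulo 2\<close>

text \<open>In the convolution \<open>i\<close> pairs off with \<open>n - i\<close>, which leaves
  the middle term for even \<open>n\<close>; squaring fixes both elements of the field.\<close>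

lemma fps_nth_power2_bit: "fps_nth ((F :: bit fps)\<^sup>2) n = (if even n then fps_nth F (n div 2) else 0)"
proof -
  let ?f = "\<lambda>i. fps_nth F i * fps_nth F (n - i)"
  have "fps_nth (F\<^sup>2) n = (\<Sum>i\<in>{0..n}. ?f i)"
    by (simp add: power2_eq_square fps_mult_nth)
  also have "{0..n} = {i\<in>{0..n}. 2 * i = n} \<union> {i\<in>{0..n}. 2 * i \<noteq> n}"
    by auto
  also have "(\<Sum>i\<in>\<dots>. ?f i) = (\<Sum>i\<in>{i\<in>{0..n}. 2 * i = n}. ?f i) + (\<Sum>i\<in>{i\<in>{0..n}. 2 * i \<noteq> n}. ?f i)"
    by (rule sum.union_disjoint) auto
  also have "(\<Sum>i\<in>{i\<in>{0..n}. 2 * i \<noteq> n}. ?f i) = 0"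
    by (rule sum_involution_eq_0[of _ _ "\<lambda>i. n - i"]) (auto simp: mult.commute)
  also have "{i\<in>{0..n}. 2 * i = n} = (if even n then {n div 2} else {})"
    by auto
  also have "(\<Sum>i\<in>\<dots>. ?f i) = (if even n then ?f (n div 2) else 0)"
    by (cases "even n") (simp_all only: if_True if_False sum.empty sum.insert[OF finite.emptyI] empty_iff simp_thms add_0_right)
  also have "\<dots> = (if even n then fps_nth F (n div 2) else 0)"
  proof (rule if_cong[OF refl _ refl])
    assume "even n"
    hence "n - n div 2 = n div 2" by presburger
    thus "?f (n div 2) = fps_nth F (n div 2)"
      by (cases "fps_nth F (n div 2)") simp_all
  qed
  finally show ?thesis by simp
qed

lemma fps_nth_power4_bit: "fps_nth ((F :: bit fps) ^ 4) n = (if 4 dvd n then fps_nth F (n div 4) else 0)"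
proof -
  have "fps_nth (F ^ 4) n = fps_nth ((F\<^sup>2)\<^sup>2) n"
    by (simp flip: power_mult)
  also have "\<dots> = (if even n \<and> even (n div 2) then fps_nth F (n div 2 div 2) else 0)"
    unfolding fps_nth_power2_bit by simp
  also have "even n \<and> even (n div 2) \<longleftrightarrow> 4 dvd n"
    by presburger
  also have "n div 2 div 2 = n div 4"
    by (simp flip: div_mult2_eq)
  finally show ?thesis .
qed

lemma fps_nth_X_power_mult_power4:
  assumes "k mod 4 \<noteq> 1"
  shows "fps_nth (fps_X ^ k * (F :: bit fps) ^ 4) (4 * m + 1) = 0"
proof -
  have "\<not> 4 dvd 4 * m + 1 - k" if "k \<le> 4 * m + 1"
    using that assms by presburger
  thus ?thesis
    by (simp add: fps_X_power_mult_nth fps_nth_power4_bit del: One_nat_def)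
qed

lemma fps_nth_X_mult_power4: "fps_nth (fps_X ^ 1 * (F :: bit fps) ^ 4) (4 * m + 1) = fps_nth F m"
  unfolding fps_X_power_mult_nth fps_nth_power4_bit by simp

section \<open>Reduction of the generating function and its coefficients at
  \<open>4 m + 1\<close>\<close>

definition b21_mod_2 :: "bit fps" where
  "b21_mod_2 = Abs_fps (\<lambda>n. of_int (b21 (int n)))"

text \<open>Such products have the same integer coefficients over every ring. Applied to the
  rationals and to \<open>bit\<close>, this carries the rational definition over to characteristic
  2.\<close>

lemma fps_nth_prod_sum_X_power:
  fixes A :: "nat set" and B :: "nat \<Rightarrow> nat set"
  shows "fps_nth (\<Prod>i\<in>A. \<Sum>j\<in>B i. fps_X ^ h i j :: 'a::comm_ring_1 fps) n =
    of_int (fps_nth (\<Prod>i\<in>A. \<Sum>j\<in>B i. fps_X ^ h i j) n)"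
proof (induction A arbitrary: n rule: infinite_finite_induct)
  case (insert a A)
  have "fps_nth (\<Sum>j\<in>B a. fps_X ^ h a j :: 'a fps) n = of_int (fps_nth (\<Sum>j\<in>B a. fps_X ^ h a j) n)" for n
    by (auto simp: fps_sum_nth fps_X_power_iff intro!: sum.cong)
  thus ?case
    using insert by (simp add: fps_mult_nth)
qed simp_all

lemma fps_cong_b21_mod_2: "fps_cong n b21_mod_2 (\<Prod>i\<le>n. \<Sum>j<21. fps_X ^ ((i + 1) * j))"
  unfolding fps_cong_def
proof (intro allI impI)
  fix k assume k: "k \<le> n"
  let ?P = "\<Prod>i\<le>n. \<Sum>j<21. fps_X ^ ((i + 1) * j)"
  have "b21_gf = Abs_fps (\<lambda>n. fps_nth (\<Prod>i\<le>n. b21_factor i) n)"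
    by (rule has_prod_unique2[OF b21_factor_has_prod b21_factor_has_prod_aux])
  hence "fps_nth b21_gf k = fps_nth (\<Prod>i\<le>k. b21_factor i) k"
    by (metis fps_nth_Abs_fps)
  also have "\<dots> = fps_nth (\<Prod>i\<le>n. b21_factor i) k"
    by (rule fps_nth_prod_b21_factor_stable[OF k, symmetric])
  also have "\<dots> = of_int (fps_nth ?P k)"
    unfolding b21_factor_eq by (rule fps_nth_prod_sum_X_power)
  finally have "(of_int (b21 (int k)) :: rat) = of_int (fps_nth ?P k)"
    by (simp add: of_int_b21)
  hence "b21 (int k) = fps_nth ?P k"
    by simp
  thus "fps_nth b21_mod_2 k = fps_nth ?P k"
    unfolding b21_mod_2_def fps_nth_Abs_fps by (simp only: fps_nth_prod_sum_X_power[symmetric])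
qed

lemma b21_mod_2_mult_euler: "b21_mod_2 * euler 1 = euler 21"
proof (rule fps_cong_all_imp_eq)
  fix n
  have "fps_cong n (b21_mod_2 * euler 1)
      ((\<Prod>i<Suc n. \<Sum>j<21. fps_X ^ ((i + 1) * j)) * (\<Prod>i<Suc n. 1 - (fps_X ^ 1) ^ Suc i))"
    using fps_cong_b21_mod_2[of n] by (intro fps_cong_mult fps_cong_euler) (simp_all add: lessThan_Suc_atMost)
  also have "(\<Prod>i<Suc n. \<Sum>j<21. fps_X ^ ((i + 1) * j)) * (\<Prod>i<Suc n. 1 - (fps_X ^ 1) ^ Suc i) =
      (\<Prod>i<Suc n. 1 - (fps_X ^ 21) ^ Suc i :: bit fps)"
  proof (subst prod.distrib [symmetric], intro prod.cong refl)
    fix i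
    define x :: "bit fps" where "x = fps_X ^ Suc i"
    have "(\<Sum>j<21. fps_X ^ ((i + 1) * j)) * (1 - (fps_X ^ 1) ^ Suc i) = (\<Sum>j<21. x ^ j) * (1 - x)"
      by (simp only: x_def power_mult Suc_eq_plus1 power_one_right)
    also have "\<dots> = 1 - x ^ 21"
      by (simp only: one_diff_power_eq mult.commute)
    also have "x ^ 21 = (fps_X ^ 21) ^ Suc i"
      unfolding x_def by (simp only: power_mult [symmetric] mult.commute)
    finally show "(\<Sum>j<21. fps_X ^ ((i + 1) * j)) * (1 - (fps_X ^ 1) ^ Suc i) = (1 - (fps_X ^ 21) ^ Suc i :: bit fps)" .
  qed
  also have "fps_cong n \<dots> (euler 21)"
    by (intro fps_cong_sym[OF fps_cong_euler]) auto
  finally show "fps_cong n (b21_mod_2 * euler 1) (euler 21)" .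
qed

lemma fps_nth_b21_mod_2:
  "fps_nth b21_mod_2 (4 * m + 1) =
    of_nat (card {(x, y). jacobi_exponent 9 3 x + jacobi_exponent 6 5 y = int m})"
proof -
  define a b d where "a = euler 1" and "b = euler 3" and "d = euler 21"
  define u v where "u = inverse a" and "v = inverse b"
  define J where "J = count_fps UNIV (jacobi_exponent 6 5)"
  have au: "a * u = 1" and bv: "b * v = 1"
    using inverse_mult_eq_1[of a] inverse_mult_eq_1[of b]
    by (simp_all add: a_def b_def u_def v_def mult.commute)
  have e: "euler 4 = a ^ 4" "euler 12 = b ^ 4"
    using euler_double[of 1] euler_double[of 2] euler_double[of 3] euler_double[of 6]
    by (simp_all add: a_def b_def flip: power_mult)
  have bd: "b * d = b ^ 8 + fps_X ^ 3 * (b ^ 4 * d ^ 4) + fps_X ^ 6 * d ^ 8"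
    using euler_1_7[of 3] by (simp add: b_def d_def)
  have ab: "a ^ 3 * b ^ 3 = a ^ 12 + fps_X * b ^ 12"
    using euler_1_3 unfolding e by (simp add: a_def b_def flip: power_mult)
  have "b ^ 3 = a * J"
    using euler_3_cubed by (simp only: a_def b_def J_def)
  have F: "b21_mod_2 = d * u"
  proof -
    have "b21_mod_2 = (b21_mod_2 * a) * u"
      by (simp only: mult.assoc au mult_1_right)
    thus ?thesis
      using b21_mod_2_mult_euler by (simp only: a_def d_def)
  qed
  \<comment> \<open>The second factor is \<open>1 / (a b)\<close>, as division of
    \<open>a^3 b^3 = a^12 + q b^12\<close> by \<open>a^4 b^4\<close> shows. So
    \<open>d / a = (b d) / (a b)\<close> is a product of two sums whose terms are powers of
    \<open>q\<close> times fourth powers.\<close>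
  have "(b * d) * (a ^ 8 * v ^ 4 + fps_X * (b ^ 8 * u ^ 4)) =
      (b * d) * (a ^ 8 * v ^ 4 * (a * u) ^ 4 + fps_X * (b ^ 8 * u ^ 4 * (b * v) ^ 4))"
    by (simp only: au bv power_one mult_1_right)
  also have "\<dots> = (b * d) * ((a ^ 12 + fps_X * b ^ 12) * (u * v) ^ 4)"
    by algebra
  also have "\<dots> = (b * d) * ((a ^ 3 * b ^ 3) * (u * v) ^ 4)"
    by (simp only: ab)
  also have "\<dots> = d * u * ((a * u) ^ 3 * (b * v) ^ 4)"
    by algebra
  also have "\<dots> = b21_mod_2"
    by (simp only: au bv power_one mult_1_right F)
  finally have "b21_mod_2 = (b * d) * (a ^ 8 * v ^ 4 + fps_X * (b ^ 8 * u ^ 4))" ..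
  also have "\<dots> = fps_X ^ 0 * (b\<^sup>2 * a\<^sup>2 * v) ^ 4 + fps_X ^ 1 * (b ^ 4 * u) ^ 4
      + fps_X ^ 3 * (d * b * a\<^sup>2 * v) ^ 4 + fps_X ^ 4 * (b ^ 3 * d * u) ^ 4
      + fps_X ^ 6 * (d\<^sup>2 * a\<^sup>2 * v) ^ 4 + fps_X ^ 7 * (d\<^sup>2 * b\<^sup>2 * u) ^ 4"
    unfolding bd by algebra
  finally have "fps_nth b21_mod_2 (4 * m + 1) = fps_nth \<dots> (4 * m + 1)"
    by (rule arg_cong)
  also have "\<dots> = fps_nth (b ^ 4 * u) m"
  proof -
    have "fps_nth (fps_X ^ 0 * (G :: bit fps) ^ 4) (4 * m + 1) = 0"
      "fps_nth (fps_X ^ 3 * G ^ 4) (4 * m + 1) = 0" "fps_nth (fps_X ^ 4 * G ^ 4) (4 * m + 1) = 0"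
      "fps_nth (fps_X ^ 6 * G ^ 4) (4 * m + 1) = 0" "fps_nth (fps_X ^ 7 * G ^ 4) (4 * m + 1) = 0" for G
      by (rule fps_nth_X_power_mult_power4, simp)+
    thus ?thesis
      by (simp only: fps_add_nth fps_nth_X_mult_power4 add_0_left add_0_right)
  qed
  also have "b ^ 4 * u = b * J"
  proof -
    have "b ^ 4 * u = b * (b ^ 3 * u)"
      by algebra
    also have "b ^ 3 * u = J * (a * u)"
      unfolding \<open>b ^ 3 = a * J\<close> by (simp only: mult_ac)
    finally show ?thesis
      by (simp only: au mult_1_right)
  qed
  also have "b * J = count_fps (UNIV \<times> UNIV) (\<lambda>(x, y). jacobi_exponent 9 3 x + jacobi_exponent 6 5 y)"
    unfolding J_def b_def using count_fps_mult(2)[OF admissible_jacobi_exponent admissible_jacobi_exponent, of 3 9 5 6]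
      euler_pentagonal[of 3] by simp
  finally show ?thesis
    by (simp add: count_fps_def case_prod_unfold)
qed

lemma of_int_eq_0_bit_iff: "of_int z = (0 :: bit) \<longleftrightarrow> even z"
  by (cases "even z") (auto elim!: evenE oddE)

text \<open>Completing squares, 24 times the first exponent plus 3 is \<open>3 (6 x - 1)^2\<close>,
  and 24 times the second plus 8 is \<open>8 (3 y + 1)^2\<close>. Without representations the
  counted set is empty.\<close>

lemma b21_even:
  assumes "\<And>x y :: int. 8 * (3 * y + 1)\<^sup>2 + 3 * (6 * x - 1)\<^sup>2 \<noteq> 24 * int m + 11"
  shows "even (b21 (4 * int m + 1))"
proof -
  have "jacobi_exponent 9 3 x + jacobi_exponent 6 5 y \<noteq> int m" for x y
  proof
    assume *: "jacobi_exponent 9 3 x + jacobi_exponent 6 5 y = int m"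
    have "24 * int m + 11 = 12 * (2 * jacobi_exponent 9 3 x) + 12 * (2 * jacobi_exponent 6 5 y) + 11"
      by (simp flip: *)
    also have "\<dots> = 8 * (3 * y + 1)\<^sup>2 + 3 * (6 * x - 1)\<^sup>2"
      unfolding two_jacobi_exponent by (simp add: power2_eq_square algebra_simps)
    finally show False
      using assms[of y x] by simp
  qed
  hence "{(x, y). jacobi_exponent 9 3 x + jacobi_exponent 6 5 y = int m} = {}"
    by auto
  hence "fps_nth b21_mod_2 (4 * m + 1) = 0"
    unfolding fps_nth_b21_mod_2 by (simp only: card.empty of_nat_0)
  hence "even (b21 (int (4 * m + 1)))"
    unfolding b21_mod_2_def fps_nth_Abs_fps of_int_eq_0_bit_iff .
  thus ?thesis
    by (simp add: add.commute)
qed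

section \<open>Primes for which -6 is not a square\<close>

text \<open>By the pigeonhole principle two points of the grid \<open>A\<close> share a value of
  \<open>f\<close>; their difference is the required pair.\<close>

lemma thue:
  fixes z w :: int and p :: nat
  assumes "prime p"
  obtains s t :: int where "(s, t) \<noteq> (0, 0)" "s\<^sup>2 < int p" "t\<^sup>2 < int p" "int p dvd s * w - t * z"
proof -
  \<comment> \<open>A prime is not a square, so both inequalities in
    \<open>k^2 < p < (k + 1)^2\<close> are strict.\<close>
  define k where "k = floor_sqrt p"
  have "k\<^sup>2 \<noteq> p"
    using assms by (auto simp: prime_power_iff)
  hence k: "k\<^sup>2 < p" "p < (Suc k)\<^sup>2"
    using floor_sqrt_power2_le[of p] Suc_floor_sqrt_power2_gt[of p] by (auto simp: k_def order_less_le)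
  define A where "A = {0..int k} \<times> {0..int k}"
  define f where "f = (\<lambda>(s, t). (s * w - t * z) mod int p)"
  have p: "p > 0"
    using assms prime_gt_0_nat by blast
  have "f ` A \<subseteq> {0..<int p}"
    using p by (auto simp: f_def)
  hence "card (f ` A) \<le> p"
    using card_mono[of "{0..<int p}" "f ` A"] by simp
  also have "p < card A"
    using k(2) by (simp add: A_def power2_eq_square nat_add_distrib)
  finally have "\<not> inj_on f A"
    by (rule pigeonhole)
  then obtain s t s' t' where st: "(s, t) \<in> A" "(s', t') \<in> A" "(s, t) \<noteq> (s', t')" "f (s, t) = f (s', t')"
    unfolding inj_on_def by (metis surj_pair)
  have small: "(x - y)\<^sup>2 < int p" if "x \<in> {0..int k}" "y \<in> {0..int k}" for x y
  proof -
    have "\<bar>x - y\<bar> \<le> \<bar>int k\<bar>"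
      using that by auto
    hence "(x - y)\<^sup>2 \<le> (int k)\<^sup>2"
      by (rule abs_le_square_iff[THEN iffD1])
    also have "\<dots> < int p"
      using k(1) by (metis of_nat_less_iff of_nat_power)
    finally show ?thesis .
  qed
  show ?thesis
  proof (rule that[of "s - s'" "t - t'"])
    have "int p dvd (s * w - t * z) - (s' * w - t' * z)"
      using st(4) by (simp add: f_def mod_eq_dvd_iff)
    thus "int p dvd (s - s') * w - (t - t') * z"
      by (simp add: algebra_simps)
  qed (use st small in \<open>auto simp: A_def\<close>)
qed

lemma square_mod_24: "(x::int)\<^sup>2 mod 24 \<in> {0, 1, 4, 9, 12, 16}"
proof (subst power_mod [symmetric])
  have "[0..23::int] = [0, 1, 2, 3, 4, 5, 6, 7, 8, 9, 10, 11, 12, 13, 14, 15, 16, 17, 18, 19, 20, 21, 22, 23]"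
    by (simp add: upto.simps[of 0] upto.simps[of 1])
  moreover have "x mod 24 \<in> set [0..23]"
    using pos_mod_bound[of 24 x] unfolding set_upto atLeastAtMost_iff by simp
  ultimately have "x mod 24 \<in> set [0, 1, 2, 3, 4, 5, 6, 7, 8, 9, 10, 11, 12, 13, 14, 15, 16, 17, 18, 19, 20, 21, 22, 23]"
    by (simp only:)
  thus "(x mod 24)\<^sup>2 mod 24 \<in> {0, 1, 4, 9, 12, 16}"
    unfolding list.set by (elim insertE emptyE) simp_all
qed

text \<open>These are the two reduced positive definite forms of discriminant -24; the squares
  modulo 24 alone keep both out of the four classes.\<close>

lemma quadratic_forms_mod_24:
  fixes x y :: int
  shows "(x\<^sup>2 + 6 * y\<^sup>2) mod 24 \<notin> {13, 17, 19, 23}" and "(2 * x\<^sup>2 + 3 * y\<^sup>2) mod 24 \<notin> {13, 17, 19, 23}"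
proof -
  have vals: "(u + 6 * v) mod 24 \<notin> {13, 17, 19, 23} \<and> (2 * u + 3 * v) mod 24 \<notin> {13, 17, 19, 23}"
    if "u \<in> {0, 1, 4, 9, 12, 16}" "v \<in> {0, 1, 4, 9, 12, 16}" for u v :: int
    using that by (elim insertE emptyE) simp_all
  have "[x\<^sup>2 + 6 * y\<^sup>2 = x\<^sup>2 mod 24 + 6 * (y\<^sup>2 mod 24)] (mod 24)"
    by (intro cong_add cong_mult cong_refl) (simp_all add: cong_def)
  moreover have "[2 * x\<^sup>2 + 3 * y\<^sup>2 = 2 * (x\<^sup>2 mod 24) + 3 * (y\<^sup>2 mod 24)] (mod 24)"
    by (intro cong_add cong_mult cong_refl) (simp_all add: cong_def)
  ultimately show "(x\<^sup>2 + 6 * y\<^sup>2) mod 24 \<notin> {13, 17, 19, 23}" "(2 * x\<^sup>2 + 3 * y\<^sup>2) mod 24 \<notin> {13, 17, 19, 23}"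
    using vals[OF square_mod_24[of x] square_mod_24[of y]] by (simp_all only: cong_def not_False_eq_True)
qed

text \<open>For each \<open>j\<close> the equation either descends to a representation of
  \<open>p\<close> itself by one of the two forms or already fails modulo 24.\<close>

lemma not_multiple_of_prime:
  fixes s t j :: int and p :: nat
  assumes "p mod 24 \<in> {13, 17, 19, 23}" "0 < j" "j < 7"
  shows "s\<^sup>2 + 6 * t\<^sup>2 \<noteq> j * int p"
proof
  assume eq: "s\<^sup>2 + 6 * t\<^sup>2 = j * int p"
  define q where "q = int p"
  have "q mod 24 = int (p mod 24)"
    by (simp add: q_def zmod_int)
  hence q: "q mod 24 \<in> {13, 17, 19, 23}"
    using assms(1) by auto
  have form1: "q \<noteq> x\<^sup>2 + 6 * y\<^sup>2" and form2: "q \<noteq> 2 * x\<^sup>2 + 3 * y\<^sup>2" for x y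
    using q quadratic_forms_mod_24[of x y] by auto
  have eq: "s\<^sup>2 + 6 * t\<^sup>2 = j * q"
    using eq by (simp add: q_def)
  have "j = 1 \<or> j = 2 \<or> j = 3 \<or> j = 4 \<or> j = 5 \<or> j = 6"
    using assms(2,3) by arith
  then consider "j = 1" | "j = 5" | "even j" | "j = 3"
    by auto
  thus False
  proof cases
    case 1
    thus False using form1[of s t] eq by simp
  next
    \<comment> \<open>Multiplication by 5 permutes the residues 13, 17, 19, 23 modulo 24.\<close>
    case 2
    hence "(s\<^sup>2 + 6 * t\<^sup>2) mod 24 = (5 * (q mod 24)) mod 24"
      unfolding eq by (simp only: mod_mult_right_eq)
    thus False
      using q quadratic_forms_mod_24(1)[of s t] by auto
  next
    \<comment> \<open>Halving gives the other form with \<open>i = j / 2\<close>; for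
      \<open>i = 2\<close> and \<open>i = 3\<close> a division by \<open>i\<close> leads back to the
      first form.\<close>
    case 3
    hence "even (s\<^sup>2 + 6 * t\<^sup>2)"
      unfolding eq by simp
    hence "even s" by simp
    then obtain s' where s: "s = 2 * s'" by (elim evenE)
    obtain i where j: "j = 2 * i" using 3 by (elim evenE)
    have eq': "2 * s'\<^sup>2 + 3 * t\<^sup>2 = i * q"
      using eq by (simp add: s j power_mult_distrib)
    have "i = 1 \<or> i = 2 \<or> i = 3"
      using assms(2,3) j by auto
    thus False
    proof (elim disjE)
      assume "i = 1"
      thus False using form2[of s' t] eq' by simp
    next
      assume i: "i = 2"
      hence "even (2 * s'\<^sup>2 + 3 * t\<^sup>2)"
        unfolding eq' by simp
      hence "even t" by simp
      then obtain t' where "t = 2 * t'" by (elim evenE)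
      thus False
        using eq' i form1[of s' t'] by (simp add: power_mult_distrib)
    next
      assume i: "i = 3"
      hence "2 * s'\<^sup>2 = 3 * (q - t\<^sup>2)"
        using eq' by simp
      hence "3 dvd 2 * s'\<^sup>2"
        by simp
      hence "3 dvd s'"
        using prime_dvd_mult_iff[of "3::int"] prime_dvd_power_iff[of "3::int" 2 s'] by auto
      then obtain r where "s' = 3 * r" by (elim dvdE)
      thus False
        using eq' i form1[of t r] by (simp add: power_mult_distrib)
    qed
  next
    case 4
    hence "s\<^sup>2 = 3 * (q - 2 * t\<^sup>2)"
      using eq by simp
    hence "3 dvd s\<^sup>2"
      by simp
    hence "3 dvd s"
      using prime_dvd_power_iff[of "3::int" 2 s] by auto
    then obtain r where "s = 3 * r" by (elim dvdE)
    thus False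
      using eq 4 form2[of t r] by (simp add: power_mult_distrib)
  qed
qed

text \<open>If \<open>p\<close> did not divide \<open>w\<close>, then \<open>z / w\<close> would be
  a square root of -6 modulo \<open>p\<close>. Thue's lemma replaces it by a quotient of small
  \<open>s\<close> and \<open>t\<close>, so that \<open>s^2 + 6 t^2 = j p\<close> with
  \<open>0 < j < 7\<close>, which is impossible. No quadratic reciprocity enters.\<close>

lemma prime_dvd_form_6:
  fixes z w :: int and p :: nat
  assumes "prime p" "p mod 24 \<in> {13, 17, 19, 23}" "int p dvd z\<^sup>2 + 6 * w\<^sup>2"
  shows "int p dvd w"
proof (rule ccontr)
  assume w: "\<not> int p dvd w"
  obtain s t where st: "(s, t) \<noteq> (0, 0)" "s\<^sup>2 < int p" "t\<^sup>2 < int p" "int p dvd s * w - t * z"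
    using thue[OF assms(1)] by metis
  have "(s\<^sup>2 + 6 * t\<^sup>2) * w\<^sup>2 = (s * w - t * z) * (s * w + t * z) + t\<^sup>2 * (z\<^sup>2 + 6 * w\<^sup>2)"
    by algebra
  moreover have "int p dvd \<dots>"
    using st(4) assms(3) by simp
  ultimately have "int p dvd (s\<^sup>2 + 6 * t\<^sup>2) * w\<^sup>2"
    by simp
  moreover have "prime (int p)"
    using assms(1) by simp
  ultimately have "int p dvd s\<^sup>2 + 6 * t\<^sup>2"
    using w by (metis prime_dvd_mult_iff prime_dvd_power)
  then obtain j where j: "s\<^sup>2 + 6 * t\<^sup>2 = j * int p"
    by (metis dvdE mult.commute)
  have "0 < s\<^sup>2 + 6 * t\<^sup>2"
    using st(1) by (cases "s = 0") (auto intro: add_pos_nonneg)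
  moreover have "s\<^sup>2 + 6 * t\<^sup>2 < 7 * int p"
    using st(2,3) by linarith
  moreover have "0 < int p"
    using assms(1) prime_gt_0_nat by simp
  ultimately have "0 < j" "j < 7"
    unfolding j by (simp_all add: zero_less_mult_iff)
  thus False
    using not_multiple_of_prime[OF assms(2)] j by blast
qed

section \<open>The arithmetic progression modulo the square of \<open>p\<close>\<close>

theorem theorem2p9:
  fixes p :: nat and c n k :: int
  assumes "prime p"
    and "p mod 24 \<in> {13, 17, 19, 23}"
    and "[24 * c = 1] (mod (int p ^ 2))"
    and "0 \<le> n"
    and "1 \<le> k" and "k < int p"
  shows "[b21 (4 * (int p ^ 2 * n + k * int p - 11 * c) + 1) = 0] (mod 2)"
proof -
  define M where "M = int p ^ 2 * n + k * int p - 11 * c"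
  have prime: "prime (int p)"
    using assms(1) by simp
  \<comment> \<open>The residue modulo 24 forces \<open>p \<ge> 13\<close>, so \<open>p\<close> is
    prime to 24; since \<open>1 \<le> k < p\<close>, it is also prime to \<open>k\<close>.\<close>
  have p24: "\<not> int p dvd 24 * k"
  proof
    assume "int p dvd 24 * k"
    moreover have "\<not> int p dvd k"
      using assms(5,6) zdvd_not_zless[of k "int p"] by auto
    ultimately have "int p dvd 2 ^ 3 * 3"
      using prime by (simp add: prime_dvd_mult_iff)
    hence "int p dvd 2 \<or> int p dvd 3"
      using prime by (metis prime_dvd_mult_iff prime_dvd_power)
    hence "p dvd 2 \<or> p dvd 3"
      by (metis of_nat_dvd_iff of_nat_numeral)
    hence "p \<le> 3"
      by (auto dest: dvd_imp_le)
    moreover have "p \<ge> 13"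
      using assms(2) by (auto intro: order_trans[OF _ mod_less_eq_dividend[of p 24]])
    ultimately show False
      by simp
  qed
  have "even (b21 (4 * M + 1))"
  proof (cases "M \<ge> 0")
    \<comment> \<open>As \<open>c\<close> is any integer in its class, the argument may be negative,
      where \<open>b21\<close> is 0.\<close>
    case False
    thus ?thesis by (simp add: b21_def)
  next
    case True
    have "8 * (3 * y + 1)\<^sup>2 + 3 * (6 * x - 1)\<^sup>2 \<noteq> 24 * int (nat M) + 11" for x y :: int
    proof
      assume "8 * (3 * y + 1)\<^sup>2 + 3 * (6 * x - 1)\<^sup>2 = 24 * int (nat M) + 11"
      hence rep: "8 * (3 * y + 1)\<^sup>2 + 3 * (6 * x - 1)\<^sup>2 = 24 * M + 11"
        using True by simp
      obtain e where e: "1 - 24 * c = int p ^ 2 * e"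
        using assms(3) by (metis cong_iff_dvd_diff cong_sym dvdE)
      \<comment> \<open>The shift by \<open>-11 c\<close> contributes \<open>11 (1 - 24 c)\<close>,
        a multiple of \<open>p^2\<close>, so that only \<open>24 k p\<close> remains modulo
        \<open>p^2\<close>.\<close>
      have val: "24 * M + 11 = int p ^ 2 * (24 * n + 11 * e) + int p * (24 * k)"
      proof -
        have "24 * M + 11 = int p ^ 2 * (24 * n) + int p * (24 * k) + 11 * (1 - 24 * c)"
          by (simp add: M_def algebra_simps)
        thus ?thesis
          unfolding e by (simp add: algebra_simps)
      qed
      define z w where "z = 6 * x - 1" and "w = 3 * y + 1"
      have "int p dvd 24 * M + 11"
        unfolding val by (simp add: power2_eq_square)
      hence dvd: "int p dvd 8 * w\<^sup>2 + 3 * z\<^sup>2"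
        using rep by (simp add: z_def w_def)
      \<comment> \<open>Multiplying by 3 and by 2 puts the form into the shape
        \<open>u^2 + 6 v^2\<close>, once with \<open>v = 2 w\<close> and once with
        \<open>v = z\<close>, so that \<open>prime_dvd_form_6\<close> applies to both
        variables.\<close>
      have "(3 * z)\<^sup>2 + 6 * (2 * w)\<^sup>2 = 3 * (8 * w\<^sup>2 + 3 * z\<^sup>2)"
        "(4 * w)\<^sup>2 + 6 * z\<^sup>2 = 2 * (8 * w\<^sup>2 + 3 * z\<^sup>2)"
        by algebra+
      hence "int p dvd 2 * w" "int p dvd z"
        using dvd prime_dvd_form_6[OF assms(1,2)] by (metis dvd_mult)+
      moreover have "\<not> int p dvd 2"
        using p24 by (metis dvd_mult2 dvd_trans dvd_def mult_2 numeral_Bit0)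
      ultimately have "int p dvd w" "int p dvd z"
        using prime by (auto simp: prime_dvd_mult_iff)
      hence "int p ^ 2 dvd 8 * w\<^sup>2 + 3 * z\<^sup>2"
        by (intro dvd_add dvd_mult dvd_power_same)
      hence "int p ^ 2 dvd int p ^ 2 * (24 * n + 11 * e) + int p * (24 * k)"
        using rep unfolding val by (simp add: z_def w_def)
      hence "int p * int p dvd int p * (24 * k)"
        by (simp add: power2_eq_square dvd_add_right_iff)
      hence "int p dvd 24 * k"
        using prime by simp
      thus False
        using p24 by simp
    qed
    hence "even (b21 (4 * int (nat M) + 1))"
      by (rule b21_even)
    thus ?thesis
      using True by simp
  qed
  thus ?thesis
    by (simp add: M_def cong_0_iff)
qed

end
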